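(* Let $s,\sigma>0$ and let $E$ be an ordered basis of $\mathbf R^d$. Then the following is true: (1) if $s+\sigma<1$ and $F\in\mathcal E^{\sigma,s}_{Z,E}(\mathbf R^{2d})$, then $F=0$; (2) if $s+\sigma<1$ or $s=\sigma=\frac12$, and $F\in\mathcal E^{\sigma,s;0}_{Z,E}(\mathbf R^{2d})$, then $F=0$.
   Context: For an ordered basis $E=\{e_1,\dots,e_d\}$ of $\mathbf R^d$, the dual basis $E'=\{e_1',\dots,e_d'\}$ is defined by $\langle e_j,e_k'\rangle=2\pi\delta_{jk}$; $\Lambda_E=\{n_1e_1+\cdots+n_de_d : n\in\mathbf Z^d\}$ and $\Lambda_E'=\Lambda_{E'}$. $F$ on $\mathbf R^{2d}$ is quasi-periodic of order $E$ if $F(x+k,\xi)=e^{i\langle k,\xi\rangle}F(x,\xi)$ and $F(x,\xi+\kappa)=F(x,\xi)$ for all $k\in\Lambda_E$, $\kappa\in\Lambda_E'$, $x,\xi\in\mathbf R^d$. $\mathcal E^{\sigma,s}_{Z,E}(\mathbf R^{2d})$ (respectively $\mathcal E^{\sigma,s;0}_{Z,E}(\mathbf R^{2d})$) is the set of all $F\in C^\infty(\mathbf R^{2d})$ which are quasi-periodic of order $E$ and such that for every compact $K\subseteq\mathbf R^{2d}$, $$\sup_{\alpha,\beta\in\mathbf N^d}\sup_{(x,\xi)\in K}\frac{|\partial_x^\alpha\partial_\xi^\beta F(x,\xi)|}{h^{|\alpha+\beta|}\alpha!^\sigma\beta!^s}<\infty$$ for some $h>0$ (respectively for every $h>0$).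 *)

theory Defs
  imports "HOL-Analysis.Analysis"
begin

section \<open>Ordered bases, dual bases and lattices\<close>

text \<open>The space $\mathbf R^d$ is \<^typ>\<open>real^'n\<close> with $d$ = \<open>CARD('n)\<close>; a basis
  $e_1, \dots, e_d$ is a family indexed by the coordinate type \<^typ>\<open>'n\<close>.\<close>

definition ordered_basis :: "('n::finite \<Rightarrow> real^'n) \<Rightarrow> bool" where
  "ordered_basis E \<longleftrightarrow> inj E \<and> independent (range E) \<and> span (range E) = UNIV"

definition dual_basis :: "('n::finite \<Rightarrow> real^'n) \<Rightarrow> ('n \<Rightarrow> real^'n)" where
  "dual_basis E = (THE E'. \<forall>j k. E j \<bullet> E' k = 2 * pi * (if j = k then 1 else 0))"

definition basis_lattice :: "('n::finite \<Rightarrow> real^'n) \<Rightarrow> (real^'n) set" where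
  "basis_lattice E = {\<Sum>i\<in>UNIV. of_int (m i) *\<^sub>R E i | m :: 'n \<Rightarrow> int. True}"

lemma dual_basis_ex1:
  fixes E :: "'n::finite \<Rightarrow> real^'n"
  assumes "ordered_basis E"
  shows "\<exists>!E'. \<forall>j k. E j \<bullet> E' k = 2 * pi * (if j = k then 1 else 0)"
proof -
  from assms have inj: "inj E" and ind: "independent (range E)" and sp: "span (range E) = UNIV"
    by (auto simp: ordered_basis_def)
  have "\<exists>v. \<forall>j. E j \<bullet> v = 2 * pi * (if j = k then 1 else 0)" for k
  proof -
    obtain f :: "real^'n \<Rightarrow> real" where f: "linear f"
      "\<And>x. x \<in> range E \<Longrightarrow> f x = 2 * pi * (if inv E x = k then 1 else 0)"
      using linear_independent_extend[OF ind, of "\<lambda>x. 2 * pi * (if inv E x = k then 1 else 0)"]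
      by blast
    have "E j \<bullet> adjoint f 1 = 2 * pi * (if j = k then 1 else 0)" for j
      using f(2)[of "E j"] adjoint_works[OF f(1), of "E j" 1] inj by simp
    then show ?thesis by blast
  qed
  then have ex: "\<exists>E'. \<forall>j k. E j \<bullet> E' k = 2 * pi * (if j = k then 1 else 0)"
    by metis
  have uniq: "v = w" if "\<And>j. E j \<bullet> v = E j \<bullet> w" for v w
  proof -
    have "(v - w) \<bullet> (v - w) = 0"
    proof (rule orthogonal_to_span[of "v - w" "range E", unfolded orthogonal_def])
      show "v - w \<in> span (range E)" using sp by simp
    next
      fix x assume "x \<in> range E"
      then show "(v - w) \<bullet> x = 0"
        using that by (auto simp: inner_diff_right inner_commute[of "v - w"])
    qed
    then show ?thesis by simp
  qed
  show ?thesis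
  proof (rule ex_ex1I[OF ex])
    fix A B
    assume "\<forall>j k. E j \<bullet> A k = 2 * pi * (if j = k then 1 else 0)"
       and "\<forall>j k. E j \<bullet> B k = 2 * pi * (if j = k then 1 else 0)"
    then show "A = B" by (intro ext uniq) simp
  qed
qed

lemma dual_basis:
  assumes "ordered_basis E"
  shows "E j \<bullet> dual_basis E k = 2 * pi * (if j = k then 1 else 0)"
  using theI'[OF dual_basis_ex1[OF assms]] unfolding dual_basis_def by blast


section \<open>Smooth functions and partial derivatives\<close>

text \<open>The derivative in direction \<open>v\<close>. Outside points of differentiability the value is
  arbitrary; it is only used for smooth functions.\<close>

definition dir_deriv ::
  "'a::euclidean_space \<Rightarrow> ('a \<Rightarrow> 'b::real_normed_vector) \<Rightarrow> 'a \<Rightarrow> 'b" where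
  "dir_deriv v f = (\<lambda>p. frechet_derivative f (at p) v)"

primrec Cn_fun :: "nat \<Rightarrow> ('a::euclidean_space \<Rightarrow> 'b::real_normed_vector) \<Rightarrow> bool" where
  "Cn_fun 0 f \<longleftrightarrow> continuous_on UNIV f"
| "Cn_fun (Suc n) f \<longleftrightarrow>
     (\<forall>p. f differentiable (at p)) \<and> (\<forall>b\<in>Basis. Cn_fun n (dir_deriv b f))"

definition smooth_fun :: "('a::euclidean_space \<Rightarrow> 'b::real_normed_vector) \<Rightarrow> bool" where
  "smooth_fun f \<longleftrightarrow> (\<forall>n. Cn_fun n f)"

text \<open>Some enumeration of the coordinates, used to fix the order in which partial derivatives are
  taken. By symmetry of mixed partials this choice does not matter for smooth functions.\<close>

definition coord_list :: "'n::finite list" where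
  "coord_list = (SOME is. distinct is \<and> set is = UNIV)"

lemma coord_list: "distinct (coord_list :: 'n::finite list)" "set (coord_list :: 'n list) = UNIV"
proof -
  have "\<exists>is :: 'n list. distinct is \<and> set is = UNIV"
    using finite_distinct_list[of "UNIV :: 'n set"] by auto
  from someI_ex[OF this]
  show "distinct (coord_list :: 'n list)" "set (coord_list :: 'n list) = UNIV"
    unfolding coord_list_def by auto
qed

text \<open>The operator $\prod_i \partial_{e_i}^{\alpha_i}$.\<close>

definition multi_deriv ::
  "('n::finite \<Rightarrow> 'a::euclidean_space) \<Rightarrow> ('n \<Rightarrow> nat) \<Rightarrow> ('a \<Rightarrow> 'b::real_normed_vector) \<Rightarrow> 'a \<Rightarrow> 'b"
where
  "multi_deriv e \<alpha> f = foldr (\<lambda>i. dir_deriv (e i) ^^ \<alpha> i) coord_list f"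

text \<open>$\partial_x^\alpha \partial_\xi^\beta F$, where a point of $\mathbf R^{2d}$ is a pair
  $(x, \xi)$.\<close>

definition mixed_deriv ::
  "('n::finite \<Rightarrow> nat) \<Rightarrow> ('n \<Rightarrow> nat) \<Rightarrow> ((real^'n) \<times> (real^'n) \<Rightarrow> complex)
     \<Rightarrow> (real^'n) \<times> (real^'n) \<Rightarrow> complex" where
  "mixed_deriv \<alpha> \<beta> F =
     multi_deriv (\<lambda>i. (axis i 1, 0)) \<alpha> (multi_deriv (\<lambda>i. (0, axis i 1)) \<beta> F)"

definition multi_fact :: "('n::finite \<Rightarrow> nat) \<Rightarrow> real" where
  "multi_fact \<alpha> = (\<Prod>i\<in>UNIV. fact (\<alpha> i))"


section \<open>Quasi-periodic functions and the spaces of quasi-periodic Gevrey functions\<close>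

definition quasi_periodic ::
  "('n::finite \<Rightarrow> real^'n) \<Rightarrow> ((real^'n) \<times> (real^'n) \<Rightarrow> complex) \<Rightarrow> bool" where
  "quasi_periodic E F \<longleftrightarrow>
     (\<forall>k\<in>basis_lattice E. \<forall>x \<xi>. F (x + k, \<xi>) = exp (\<i> * of_real (k \<bullet> \<xi>)) * F (x, \<xi>)) \<and>
     (\<forall>\<kappa>\<in>basis_lattice (dual_basis E). \<forall>x \<xi>. F (x, \<xi> + \<kappa>) = F (x, \<xi>))"

text \<open>Finiteness of the supremum over all \<open>\<alpha>\<close>, \<open>\<beta>\<close> and all points of \<open>K\<close>. The order \<open>\<sigma>\<close> belongs
  to the \<open>x\<close>-derivatives, \<open>s\<close> to the \<open>\<xi>\<close>-derivatives.\<close>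

definition gevrey_bounded ::
  "real \<Rightarrow> real \<Rightarrow> real \<Rightarrow> ((real^'n::finite) \<times> (real^'n)) set
     \<Rightarrow> ((real^'n) \<times> (real^'n) \<Rightarrow> complex) \<Rightarrow> bool" where
  "gevrey_bounded \<sigma> s h K F \<longleftrightarrow>
     bdd_above ((\<lambda>(\<alpha>, \<beta>, p).
       norm (mixed_deriv \<alpha> \<beta> F p) /
         (h ^ (\<Sum>i\<in>UNIV. \<alpha> i + \<beta> i) * multi_fact \<alpha> powr \<sigma> * multi_fact \<beta> powr s))
       ` (UNIV \<times> UNIV \<times> K))"

definition zak_gevrey ::
  "real \<Rightarrow> real \<Rightarrow> ('n::finite \<Rightarrow> real^'n) \<Rightarrow> ((real^'n) \<times> (real^'n) \<Rightarrow> complex) set" where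
  "zak_gevrey \<sigma> s E = {F. smooth_fun F \<and> quasi_periodic E F \<and>
     (\<forall>K. compact K \<longrightarrow> (\<exists>h>0. gevrey_bounded \<sigma> s h K F))}"

definition zak_gevrey0 ::
  "real \<Rightarrow> real \<Rightarrow> ('n::finite \<Rightarrow> real^'n) \<Rightarrow> ((real^'n) \<times> (real^'n) \<Rightarrow> complex) set" where
  "zak_gevrey0 \<sigma> s E = {F. smooth_fun F \<and> quasi_periodic E F \<and>
     (\<forall>K. compact K \<longrightarrow> (\<forall>h>0. gevrey_bounded \<sigma> s h K F))}"

end

theory Submission
  imports Defs "HOL-Complex_Analysis.Cauchy_Integral_Formula"
begin

text \<open>Let \<open>v = E j\<close> and let \<open>w\<close> be the dual vector, so that \<open>v \<bullet> w = 2\<pi>\<close>. If \<open>v \<bullet> \<eta> = 0\<close>, then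
  \<open>f t = \<integral>\<^sub>0\<^sup>1 F (y + t v, \<eta> + u w) du\<close> satisfies
  \<open>f (t + k) = \<integral>\<^sub>0\<^sup>1 e\<^bsup>2\<pi>iku\<^esup> F (y + t v, \<eta> + u w) du\<close>, and integrating by parts in \<open>u\<close> turns the bounds on
  the \<open>\<xi>\<close>-derivatives into decay of \<open>f\<close> and all its derivatives on the real line:
  \<open>\<bar>x\<bar>\<^sup>b \<bar>f\<^bsup>(a)\<^esup> x\<bar> \<le> C H\<^bsup>a + b\<^esup> a!\<^sup>\<sigma> b!\<^sup>s\<close>. As \<open>\<sigma> < 1\<close>, \<open>f\<close> extends to an entire function \<open>\<Phi>\<close>. Its
  decay along the real axis beats its growth in the imaginary direction, so \<open>\<Phi> z \<Phi> (i z)\<close> vanishes at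
  infinity; by Liouville it is \<open>0\<close>, whence \<open>f 0 = 0\<close>. Applied with \<open>y + k v\<close> in place of \<open>y\<close>, this
  says that all Fourier coefficients of \<open>u \<mapsto> F (y, \<eta> + u w)\<close> vanish, and every point of the phase
  space lies on such a line.\<close>

section \<open>Directional derivatives of smooth functions\<close>

lemma smooth_fun_differentiable: "smooth_fun f \<Longrightarrow> f differentiable (at p)"
  by (auto simp: smooth_fun_def dest: spec[of _ "Suc 0"])

lemma smooth_fun_continuous: "smooth_fun f \<Longrightarrow> continuous_on S f"
  by (metis Cn_fun.simps(1) continuous_on_subset smooth_fun_def subset_UNIV)

lemma smooth_fun_dir_deriv_Basis: "smooth_fun f \<Longrightarrow> b \<in> Basis \<Longrightarrow> smooth_fun (dir_deriv b f)"
  by (metis Cn_fun.simps(2) smooth_fun_def)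

lemma smooth_fun_has_derivative:
  "smooth_fun f \<Longrightarrow> (f has_derivative (\<lambda>v. dir_deriv v f p)) (at p)"
  using smooth_fun_differentiable[of f p] frechet_derivative_works by (auto simp: dir_deriv_def)

lemma smooth_fun_linear_dir_deriv: "smooth_fun f \<Longrightarrow> linear (\<lambda>v. dir_deriv v f p)"
  using smooth_fun_has_derivative has_derivative_linear by blast

text \<open>\<open>Cn_fun\<close> constrains only derivatives along \<open>Basis\<close>. Closure
  under linear combinations carries smoothness over to every direction, because
  \<open>dir_deriv v f\<close> is a combination of the partial derivatives.\<close>

lemma Cn_fun_linear_comb:
  "Cn_fun n f \<Longrightarrow> Cn_fun n g \<Longrightarrow> Cn_fun n (\<lambda>p. c *\<^sub>R f p + g p)"
proof (induction n arbitrary: f g)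
  case 0
  then show ?case by (simp add: continuous_on_add continuous_on_scaleR)
next
  case (Suc n)
  have der: "((\<lambda>p. c *\<^sub>R f p + g p) has_derivative
      (\<lambda>b. c *\<^sub>R dir_deriv b f p + dir_deriv b g p)) (at p)" for p
    using Suc.prems unfolding dir_deriv_def Cn_fun.simps frechet_derivative_works
    by (intro has_derivative_add has_derivative_scaleR_right) blast+
  have "dir_deriv b (\<lambda>p. c *\<^sub>R f p + g p) = (\<lambda>p. c *\<^sub>R dir_deriv b f p + dir_deriv b g p)" for b
  proof
    fix p
    show "dir_deriv b (\<lambda>p. c *\<^sub>R f p + g p) p = c *\<^sub>R dir_deriv b f p + dir_deriv b g p"
      using fun_cong[OF frechet_derivative_at[OF der[of p]], of b] by (simp add: dir_deriv_def)
  qed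
  moreover have "(\<lambda>p. c *\<^sub>R f p + g p) differentiable at p" for p
    using der differentiable_def by blast
  ultimately show ?case using Suc by simp
qed

lemma smooth_fun_sum_scaleR:
  fixes f :: "'i \<Rightarrow> 'a::euclidean_space \<Rightarrow> 'b::real_normed_vector"
  assumes "finite I" "\<And>i. i \<in> I \<Longrightarrow> smooth_fun (f i)"
  shows "smooth_fun (\<lambda>p. \<Sum>i\<in>I. c i *\<^sub>R f i p)"
  using assms
proof (induction I rule: finite_induct)
  case empty
  have "Cn_fun n (\<lambda>p::'a. 0::'b)" for n :: nat
    by (induction n) (simp_all add: dir_deriv_def)
  then show ?case by (simp add: smooth_fun_def)
next
  case (insert i I)
  then show ?case by (simp add: smooth_fun_def Cn_fun_linear_comb)
qed

lemma dir_deriv_Basis_expansion: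
  assumes "smooth_fun f"
  shows "dir_deriv v f = (\<lambda>p. \<Sum>b\<in>Basis. (v \<bullet> b) *\<^sub>R dir_deriv b f p)"
proof
  fix p
  have "dir_deriv v f p = dir_deriv (\<Sum>b\<in>Basis. (v \<bullet> b) *\<^sub>R b) f p"
    by (simp add: euclidean_representation)
  also have "\<dots> = (\<Sum>b\<in>Basis. (v \<bullet> b) *\<^sub>R dir_deriv b f p)"
    using smooth_fun_linear_dir_deriv[OF assms, of p]
    by (simp only: linear_sum[of "\<lambda>v. dir_deriv v f p"] linear_scale[of "\<lambda>v. dir_deriv v f p"])
  finally show "dir_deriv v f p = (\<Sum>b\<in>Basis. (v \<bullet> b) *\<^sub>R dir_deriv b f p)" .
qed

lemma smooth_fun_dir_deriv: "smooth_fun f \<Longrightarrow> smooth_fun (dir_deriv v f)"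
  by (subst dir_deriv_Basis_expansion, assumption, intro smooth_fun_sum_scaleR finite_Basis smooth_fun_dir_deriv_Basis)

lemma smooth_fun_line_derivative:
  assumes "smooth_fun f"
  shows "((\<lambda>t. f (q + t *\<^sub>R v)) has_vector_derivative dir_deriv v f (q + t *\<^sub>R v)) (at t within S)"
proof -
  have "((\<lambda>t. q + t *\<^sub>R v) has_derivative (\<lambda>t. t *\<^sub>R v)) (at t within S)"
    by (auto intro!: derivative_eq_intros)
  from has_derivative_compose[OF this smooth_fun_has_derivative[OF assms]]
  show ?thesis
    using smooth_fun_linear_dir_deriv[OF assms]
    by (simp add: has_vector_derivative_def linear_iff)
qed

text \<open>The increment of \<open>f\<close> along \<open>u\<close> is the integral of its \<open>u\<close>-derivative; differentiate this
  identity under the integral along \<open>v\<close>, and then with respect to the upper limit.\<close>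

lemma dir_deriv_commute:
  fixes f :: "'a::euclidean_space \<Rightarrow> 'b::banach"
  assumes f: "smooth_fun f"
  shows "dir_deriv u (dir_deriv v f) = dir_deriv v (dir_deriv u f)"
proof
  fix p
  note sm = f smooth_fun_dir_deriv[OF f]
  let ?uv = "dir_deriv v (dir_deriv u f)"
  note cont = continuous_on_compose2[OF smooth_fun_continuous[OF sm(2)[of u], of UNIV]]
    continuous_on_compose2[OF smooth_fun_continuous[OF smooth_fun_dir_deriv[OF sm(2)], of UNIV v u]]
  have 1: "f (p + t *\<^sub>R v + x *\<^sub>R u) - f (p + t *\<^sub>R v) =
      integral {0..x} (\<lambda>r. dir_deriv u f (p + t *\<^sub>R v + r *\<^sub>R u))" if "0 \<le> x" for x t
    using integral_unique[OF fundamental_theorem_of_calculus[OF that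
        smooth_fun_line_derivative[OF f, of "p + t *\<^sub>R v" u]]] by simp
  have 2: "dir_deriv v f (p + x *\<^sub>R u) - dir_deriv v f p = integral {0..x} (\<lambda>r. ?uv (p + r *\<^sub>R u))"
    if "0 \<le> x" for x
  proof -
    have "((\<lambda>t. integral (cbox 0 x) (\<lambda>r. dir_deriv u f (p + t *\<^sub>R v + r *\<^sub>R u)))
        has_vector_derivative integral (cbox 0 x) (\<lambda>r. ?uv (p + 0 *\<^sub>R v + r *\<^sub>R u))) (at 0 within UNIV)"
    proof (rule leibniz_rule_vector_derivative)
      fix t r
      show "((\<lambda>t. dir_deriv u f (p + t *\<^sub>R v + r *\<^sub>R u)) has_vector_derivative ?uv (p + t *\<^sub>R v + r *\<^sub>R u)) (at t within UNIV)"
        using smooth_fun_line_derivative[OF sm(2)[of u], of "p + r *\<^sub>R u" v t UNIV]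
        by (simp add: add_ac)
    qed (auto intro!: integrable_continuous_real cont continuous_intros simp: split_beta)
    then have "((\<lambda>t. f (p + t *\<^sub>R v + x *\<^sub>R u) - f (p + t *\<^sub>R v))
        has_vector_derivative integral {0..x} (\<lambda>r. ?uv (p + r *\<^sub>R u))) (at 0)"
      using that by (simp add: 1)
    moreover have "((\<lambda>t. f (p + t *\<^sub>R v + x *\<^sub>R u) - f (p + t *\<^sub>R v))
        has_vector_derivative dir_deriv v f (p + x *\<^sub>R u) - dir_deriv v f p) (at 0)"
      using has_vector_derivative_diff[OF smooth_fun_line_derivative[OF f, of "p + x *\<^sub>R u" v 0 UNIV]
        smooth_fun_line_derivative[OF f, of p v 0 UNIV]] by (simp add: add_ac)
    ultimately show ?thesis using vector_derivative_unique_at by blast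
  qed
  \<comment> \<open>Identity \<open>2\<close> is available for \<open>0 \<le> x\<close> only, so the
    derivatives at \<open>0\<close> are compared within \<open>{0..1}\<close>, where they are still
    unique.\<close>
  have "((\<lambda>x. integral {0..x} (\<lambda>r. ?uv (p + r *\<^sub>R u))) has_vector_derivative ?uv (p + 0 *\<^sub>R u)) (at 0 within {0..1})"
    by (rule integral_has_vector_derivative) (auto intro!: cont continuous_intros)
  then have "((\<lambda>x. integral {0..x} (\<lambda>r. ?uv (p + r *\<^sub>R u))) has_vector_derivative ?uv p) (at 0 within {0..1})"
    by simp
  then have "((\<lambda>x. dir_deriv v f (p + x *\<^sub>R u) - dir_deriv v f p) has_vector_derivative ?uv p) (at 0 within {0..1})"
    by (rule has_vector_derivative_transform[rotated 2]) (simp_all add: 2)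
  moreover have "((\<lambda>x. dir_deriv v f (p + x *\<^sub>R u) - dir_deriv v f p) has_vector_derivative dir_deriv u (dir_deriv v f) p) (at 0 within {0..1})"
    using has_vector_derivative_diff[OF smooth_fun_line_derivative[OF sm(2)[of v], of p u 0 "{0..1}"] has_vector_derivative_const]
    by simp
  ultimately show "dir_deriv u (dir_deriv v f) p = ?uv p"
    by (intro vector_derivative_unique_within_closed_interval[of 0 1 0]) (auto simp: cbox_interval)
qed

section \<open>Reordering iterated derivatives\<close>

lemma smooth_fun_dir_deriv_funpow: "smooth_fun f \<Longrightarrow> smooth_fun ((dir_deriv v ^^ n) f)"
  by (induction n) (auto intro: smooth_fun_dir_deriv)

lemma dir_deriv_funpow_commute:
  fixes f :: "'a::euclidean_space \<Rightarrow> 'b::banach"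
  shows "smooth_fun f \<Longrightarrow> dir_deriv u ((dir_deriv v ^^ n) f) = (dir_deriv v ^^ n) (dir_deriv u f)"
  by (induction n) (simp_all add: dir_deriv_commute[of _ u v] smooth_fun_dir_deriv_funpow)

lemma smooth_fun_foldr_dir_deriv:
  "smooth_fun f \<Longrightarrow> smooth_fun (foldr (\<lambda>i. dir_deriv (e i) ^^ \<alpha> i) is f)"
  by (induction "is") (auto intro: smooth_fun_dir_deriv_funpow)

lemma dir_deriv_foldr_commute:
  fixes f :: "'a::euclidean_space \<Rightarrow> 'b::banach"
  shows "smooth_fun f \<Longrightarrow> dir_deriv u (foldr (\<lambda>i. dir_deriv (e i) ^^ \<alpha> i) is f)
    = foldr (\<lambda>i. dir_deriv (e i) ^^ \<alpha> i) is (dir_deriv u f)"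
  by (induction "is") (simp_all add: dir_deriv_funpow_commute smooth_fun_foldr_dir_deriv)

text \<open>Distinctness makes \<open>i\<close> occur exactly once in the list, so only one factor
  gains a derivative; that derivative then commutes past all later factors to the innermost
  place.\<close>

lemma foldr_dir_deriv_Suc:
  fixes f :: "'a::euclidean_space \<Rightarrow> 'b::banach"
  assumes "smooth_fun f" "distinct is" "i \<in> set is"
  shows "foldr (\<lambda>j. dir_deriv (e j) ^^ (\<alpha>(i := Suc (\<alpha> i))) j) is f
    = foldr (\<lambda>j. dir_deriv (e j) ^^ \<alpha> j) is (dir_deriv (e i) f)"
  using assms(2,3)
proof (induction "is")
  case (Cons j js)
  show ?case
  proof (cases "j = i")
    case True
    with Cons.prems have "i \<notin> set js" by auto
    then have "foldr (\<lambda>j. dir_deriv (e j) ^^ (\<alpha>(i := Suc (\<alpha> i))) j) js f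
        = foldr (\<lambda>j. dir_deriv (e j) ^^ \<alpha> j) js f"
      by (intro foldr_cong) auto
    then show ?thesis
      by (simp only: foldr.simps o_apply True fun_upd_same funpow_Suc_right
          dir_deriv_foldr_commute[OF assms(1)])
  next
    case False
    with Cons show ?thesis by auto
  qed
qed simp

lemma multi_deriv_Suc:
  fixes f :: "'a::euclidean_space \<Rightarrow> 'b::banach"
  shows "smooth_fun f \<Longrightarrow> multi_deriv e (\<alpha>(i := Suc (\<alpha> i))) f = multi_deriv e \<alpha> (dir_deriv (e i) f)"
  unfolding multi_deriv_def by (rule foldr_dir_deriv_Suc) (simp_all add: coord_list)

lemma smooth_fun_multi_deriv: "smooth_fun f \<Longrightarrow> smooth_fun (multi_deriv e \<alpha> f)"
  unfolding multi_deriv_def by (rule smooth_fun_foldr_dir_deriv)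

text \<open>Commuting an \<open>x\<close>-derivative inward past the
  \<open>\<xi>\<close>-derivatives lets a partial derivative of \<open>F\<close> be absorbed into
  the multi-index, as inductions on the order of differentiation require.\<close>

lemma mixed_deriv_Suc:
  assumes "smooth_fun F"
  shows "mixed_deriv (\<alpha>(i := Suc (\<alpha> i))) \<beta> F = mixed_deriv \<alpha> \<beta> (dir_deriv (axis i 1, 0) F)"
    and "mixed_deriv \<alpha> (\<beta>(i := Suc (\<beta> i))) F = mixed_deriv \<alpha> \<beta> (dir_deriv (0, axis i 1) F)"
proof -
  have "dir_deriv (axis i 1, 0) (multi_deriv (\<lambda>i. (0, axis i 1)) \<beta> F)
      = multi_deriv (\<lambda>i. (0, axis i 1)) \<beta> (dir_deriv (axis i 1, 0) F)"
    unfolding multi_deriv_def by (rule dir_deriv_foldr_commute[OF assms])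
  then show "mixed_deriv (\<alpha>(i := Suc (\<alpha> i))) \<beta> F = mixed_deriv \<alpha> \<beta> (dir_deriv (axis i 1, 0) F)"
    unfolding mixed_deriv_def by (simp add: multi_deriv_Suc assms smooth_fun_multi_deriv)
  show "mixed_deriv \<alpha> (\<beta>(i := Suc (\<beta> i))) F = mixed_deriv \<alpha> \<beta> (dir_deriv (0, axis i 1) F)"
    unfolding mixed_deriv_def by (simp add: multi_deriv_Suc assms)
qed

section \<open>Directional derivatives bounded by mixed partial derivatives\<close>

lemma foldr_id: "foldr (\<lambda>_. id) xs f = f"
  by (induction xs) simp_all

lemma mixed_deriv_0: "mixed_deriv (\<lambda>_. 0) (\<lambda>_. 0) F = F"
  by (simp add: mixed_deriv_def multi_deriv_def foldr_id)

lemma dir_deriv_coord_expansion: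
  fixes F :: "(real^'n::finite) \<times> (real^'n) \<Rightarrow> 'b::real_normed_vector"
  assumes "smooth_fun F"
  shows "dir_deriv (v, 0) F p = (\<Sum>i\<in>UNIV. (v $ i) *\<^sub>R dir_deriv (axis i 1, 0) F p)"
    and "dir_deriv (0, v) F p = (\<Sum>i\<in>UNIV. (v $ i) *\<^sub>R dir_deriv (0, axis i 1) F p)"
proof -
  have v: "v = (\<Sum>i\<in>UNIV. (v $ i) *\<^sub>R axis i 1)"
    using basis_expansion[of v] by (simp add: scalar_mult_eq_scaleR)
  note lin = smooth_fun_linear_dir_deriv[OF assms, of p]
  have "(v, 0) = (\<Sum>i\<in>UNIV. (v $ i) *\<^sub>R (axis i 1, 0 :: real^'n))"
    by (subst v) (simp add: prod_eq_iff fst_sum snd_sum)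
  then show "dir_deriv (v, 0) F p = (\<Sum>i\<in>UNIV. (v $ i) *\<^sub>R dir_deriv (axis i 1, 0) F p)"
    by (simp only: linear_sum[OF lin] linear_scale[OF lin])
  have "(0, v) = (\<Sum>i\<in>UNIV. (v $ i) *\<^sub>R (0 :: real^'n, axis i 1))"
    by (subst v) (simp add: prod_eq_iff fst_sum snd_sum)
  then show "dir_deriv (0, v) F p = (\<Sum>i\<in>UNIV. (v $ i) *\<^sub>R dir_deriv (0, axis i 1) F p)"
    by (simp only: linear_sum[OF lin] linear_scale[OF lin])
qed

lemma sum_fun_upd_Suc:
  fixes \<alpha> :: "'n::finite \<Rightarrow> nat"
  shows "(\<Sum>j\<in>UNIV. (\<alpha>(i := Suc (\<alpha> i))) j) = Suc (\<Sum>j\<in>UNIV. \<alpha> j)"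
proof -
  have "\<alpha>(i := Suc (\<alpha> i)) = (\<lambda>j. \<alpha> j + (if j = i then 1 else 0))" by auto
  then show ?thesis by (simp add: sum.distrib)
qed

lemma norm_sum_scaleR_le:
  assumes "\<And>i. i \<in> I \<Longrightarrow> norm (x i) \<le> M"
  shows "norm (\<Sum>i\<in>I. c i *\<^sub>R x i) \<le> (\<Sum>i\<in>I. \<bar>c i\<bar>) * M"
  unfolding sum_distrib_right
  by (rule sum_norm_le) (simp add: mult_left_mono assms)

text \<open>Each directional derivative is expanded in coordinates and costs one factor, the l1-norm
  of its direction. The induction generalises \<open>F\<close>: the coordinate derivative commutes
  inward, and the hypothesis is used for that partial derivative of \<open>F\<close>.\<close>

lemma norm_dir_deriv_funpow_le:
  fixes F :: "(real^'n::finite) \<times> (real^'n) \<Rightarrow> complex"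
  assumes "smooth_fun F"
    and "\<And>\<alpha> \<beta>. (\<Sum>i\<in>UNIV. \<alpha> i) = a \<Longrightarrow> (\<Sum>i\<in>UNIV. \<beta> i) = b \<Longrightarrow> norm (mixed_deriv \<alpha> \<beta> F p) \<le> M"
  shows "norm ((dir_deriv (v, 0) ^^ a) ((dir_deriv (0, w) ^^ b) F) p)
    \<le> (\<Sum>i\<in>UNIV. \<bar>v $ i\<bar>) ^ a * ((\<Sum>i\<in>UNIV. \<bar>w $ i\<bar>) ^ b * M)"
  using assms
proof (induction a arbitrary: F)
  case 0
  then show ?case
  proof (induction b arbitrary: F)
    case 0
    from 0(2)[of "\<lambda>_. 0" "\<lambda>_. 0"] show ?case by (simp add: mixed_deriv_0)
  next
    case (Suc b)
    let ?W = "(dir_deriv (0, w) ^^ b)"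
    have "norm ((dir_deriv (v, 0) ^^ 0) (?W (dir_deriv (0, axis i 1) F)) p)
        \<le> (\<Sum>i\<in>UNIV. \<bar>v $ i\<bar>) ^ 0 * ((\<Sum>i\<in>UNIV. \<bar>w $ i\<bar>) ^ b * M)" for i
    proof (rule Suc.IH)
      show "smooth_fun (dir_deriv (0, axis i 1) F)" by (rule smooth_fun_dir_deriv[OF Suc.prems(1)])
      fix \<alpha> \<beta> :: "'n \<Rightarrow> nat"
      assume "(\<Sum>i\<in>UNIV. \<alpha> i) = 0" "(\<Sum>i\<in>UNIV. \<beta> i) = b"
      then show "norm (mixed_deriv \<alpha> \<beta> (dir_deriv (0, axis i 1) F) p) \<le> M"
        using Suc.prems(2)[of \<alpha> "\<beta>(i := Suc (\<beta> i))"]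
        by (simp only: sum_fun_upd_Suc flip: mixed_deriv_Suc(2)[OF Suc.prems(1)])
    qed
    then have "norm (\<Sum>i\<in>UNIV. (w $ i) *\<^sub>R ?W (dir_deriv (0, axis i 1) F) p)
        \<le> (\<Sum>i\<in>UNIV. \<bar>w $ i\<bar>) * ((\<Sum>i\<in>UNIV. \<bar>w $ i\<bar>) ^ b * M)"
      by (intro norm_sum_scaleR_le) simp
    moreover have "(dir_deriv (0, w) ^^ Suc b) F p = (\<Sum>i\<in>UNIV. (w $ i) *\<^sub>R ?W (dir_deriv (0, axis i 1) F) p)"
      unfolding funpow.simps o_apply
      by (subst dir_deriv_coord_expansion(2))
        (simp_all add: smooth_fun_dir_deriv_funpow Suc.prems(1) dir_deriv_funpow_commute)
    ultimately show ?case by (simp add: mult.assoc)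
  qed
next
  case (Suc a)
  let ?W = "\<lambda>F. (dir_deriv (v, 0) ^^ a) ((dir_deriv (0, w) ^^ b) F)"
  have "norm (?W (dir_deriv (axis i 1, 0) F) p) \<le> (\<Sum>i\<in>UNIV. \<bar>v $ i\<bar>) ^ a * ((\<Sum>i\<in>UNIV. \<bar>w $ i\<bar>) ^ b * M)" for i
    proof (rule Suc.IH)
      show "smooth_fun (dir_deriv (axis i 1, 0) F)" by (rule smooth_fun_dir_deriv[OF Suc.prems(1)])
      fix \<alpha> \<beta> :: "'n \<Rightarrow> nat"
      assume "(\<Sum>i\<in>UNIV. \<alpha> i) = a" "(\<Sum>i\<in>UNIV. \<beta> i) = b"
      then show "norm (mixed_deriv \<alpha> \<beta> (dir_deriv (axis i 1, 0) F) p) \<le> M"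
        using Suc.prems(2)[of "\<alpha>(i := Suc (\<alpha> i))" \<beta>]
        by (simp only: sum_fun_upd_Suc flip: mixed_deriv_Suc(1)[OF Suc.prems(1)])
    qed
  then have "norm (\<Sum>i\<in>UNIV. (v $ i) *\<^sub>R ?W (dir_deriv (axis i 1, 0) F) p)
      \<le> (\<Sum>i\<in>UNIV. \<bar>v $ i\<bar>) * ((\<Sum>i\<in>UNIV. \<bar>v $ i\<bar>) ^ a * ((\<Sum>i\<in>UNIV. \<bar>w $ i\<bar>) ^ b * M))"
    by (rule norm_sum_scaleR_le)
  moreover have "(dir_deriv (v, 0) ^^ Suc a) ((dir_deriv (0, w) ^^ b) F) p =
      (\<Sum>i\<in>UNIV. (v $ i) *\<^sub>R ?W (dir_deriv (axis i 1, 0) F) p)"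
    unfolding funpow.simps o_apply
    by (subst dir_deriv_coord_expansion(1))
      (simp_all add: smooth_fun_dir_deriv_funpow Suc.prems(1) dir_deriv_funpow_commute)
  ultimately show ?case by (simp add: mult.assoc)
qed

section \<open>Entire functions decaying on the real line\<close>

text \<open>The Taylor series of \<open>f 0\<close> at \<open>0\<close> converges on the whole plane
  by \<open>sm\<close>, and its remainder on the real axis tends to \<open>0\<close>, so its sum
  extends \<open>f 0\<close>. Its derivatives then restrict to the \<open>f a\<close>, and
  re-expansion about the real point \<open>x\<close> gives the stated series.\<close>

lemma entire_extension:
  fixes f :: "nat \<Rightarrow> real \<Rightarrow> complex"
  assumes der: "\<And>a x. (f a has_vector_derivative f (Suc a) x) (at x)"
    and bnd: "\<And>a x. norm (f a x) \<le> B a"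
    and sm: "\<And>r. 0 \<le> r \<Longrightarrow> summable (\<lambda>a. B a * r ^ a / fact a)"
  obtains \<Phi> where "\<Phi> holomorphic_on UNIV"
    "\<And>x y. (\<lambda>a. f a x * (\<i> * of_real y) ^ a / fact a) sums \<Phi> (Complex x y)"
proof -
  \<comment> \<open>\<open>c a\<close> lists the Taylor coefficients of \<open>f a\<close> at
    \<open>0\<close>; formal differentiation by \<open>diffs\<close> therefore maps
    \<open>c a\<close> to \<open>c (Suc a)\<close>.\<close>
  define c :: "nat \<Rightarrow> nat \<Rightarrow> complex" where "c = (\<lambda>a n. f (a + n) 0 / fact n)"
  define P where "P = (\<lambda>a z. \<Sum>n. c a n * z ^ n)"
  have diffs_c: "diffs (c a) = c (Suc a)" for a
    by (rule ext) (simp add: diffs_def c_def field_simps del: of_nat_Suc)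
  have sum0: "summable (\<lambda>n. c 0 n * z ^ n)" for z
  proof (rule summable_comparison_test[OF _ sm[of "norm z"]])
    show "\<exists>N. \<forall>n\<ge>N. norm (c 0 n * z ^ n) \<le> B n * norm z ^ n / fact n"
      unfolding times_divide_eq_left[symmetric] by (auto simp: c_def norm_mult norm_divide norm_power
          intro!: divide_right_mono mult_right_mono bnd exI[of _ 0])
  qed simp
  have sumc: "summable (\<lambda>n. c a n * z ^ n)" for a z
  proof (induction a arbitrary: z)
    case 0 show ?case by (rule sum0)
  next
    case (Suc a)
    show ?case using termdiff_converges_all[of "c a" z] Suc diffs_c by simp
  qed
  have derP: "(P a has_field_derivative P (Suc a) z) (at z)" for a z
    using termdiffs_strong_converges_everywhere[of "c a" z] sumc by (simp add: P_def diffs_c)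
  have Pf0: "P 0 (of_real x) = f 0 x" for x
  proof -
    \<comment> \<open>The complex Taylor estimate is applied on the real axis as a convex set.
      Within this line \<open>Re (w - z)\<close> equals \<open>w - z\<close>, so
      \<open>f i (Re z)\<close> has a complex derivative relative to it.\<close>
    let ?S = "{z::complex. Im z = 0}"
    have conv: "convex ?S"
      by (auto simp: convex_def)
    have F: "((\<lambda>z. f i (Re z)) has_field_derivative f (Suc i) (Re z)) (at z within ?S)"
      if z: "z \<in> ?S" for i z
    proof -
      have "((\<lambda>z. f i (Re z)) has_derivative (\<lambda>h. Re h *\<^sub>R f (Suc i) (Re z))) (at z)"
        using diff_chain_at[OF bounded_linear.has_derivative[OF bounded_linear_Re has_derivative_ident]
            der[of i "Re z", unfolded has_vector_derivative_def]]
        by (simp add: o_def)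
      then have "((\<lambda>z. f i (Re z)) has_derivative (\<lambda>h. Re h *\<^sub>R f (Suc i) (Re z))) (at z within ?S)"
        by (rule has_derivative_at_withinI)
      then have lim: "((\<lambda>w. (1 / norm (w - z)) *\<^sub>R (f i (Re w) - (f i (Re z) + Re (w - z) *\<^sub>R f (Suc i) (Re z)))) \<longlongrightarrow> 0)
          (at z within ?S)"
        by (simp add: has_derivative_within)
      have eq: "Re (w - z) *\<^sub>R f (Suc i) (Re z) = f (Suc i) (Re z) * (w - z)" if "w \<in> ?S" for w
        using that z by (simp add: complex_eq_iff)
      have "((\<lambda>w. (1 / norm (w - z)) *\<^sub>R (f i (Re w) - (f i (Re z) + f (Suc i) (Re z) * (w - z)))) \<longlongrightarrow> 0)
          (at z within ?S)"
      proof (rule Lim_transform_eventually[OF lim])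
        show "\<forall>\<^sub>F w in at z within ?S.
            (1 / norm (w - z)) *\<^sub>R (f i (Re w) - (f i (Re z) + Re (w - z) *\<^sub>R f (Suc i) (Re z))) =
            (1 / norm (w - z)) *\<^sub>R (f i (Re w) - (f i (Re z) + f (Suc i) (Re z) * (w - z)))"
          unfolding eventually_at_filter by (intro always_eventually allI impI) (simp only: eq)
      qed
      then show ?thesis
        by (simp add: has_field_derivative_def has_derivative_within bounded_linear_mult_right)
    qed
    have rem: "norm (f 0 x - (\<Sum>i\<le>n. c 0 i * of_real x ^ i)) \<le> B (Suc n) * \<bar>x\<bar> ^ Suc n / fact n" for n
      using complex_Taylor[of ?S n "\<lambda>i z. f i (Re z)" "B (Suc n)" 0 "of_real x", OF conv] F bnd
      by (simp add: c_def)
    \<comment> \<open>The remainder carries \<open>fact n\<close> instead of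
      \<open>fact (Suc n)\<close>. The missing factor \<open>Suc n\<close> is at most
      \<open>2 ^ Suc n\<close>, which is absorbed by using \<open>sm\<close> at
      \<open>2 * \<bar>x\<bar>\<close>.\<close>
    have "(\<lambda>n. B (Suc n) * \<bar>x\<bar> ^ Suc n / fact n) \<longlonglongrightarrow> 0"
    proof (rule Lim_null_comparison)
      show "(\<lambda>n. B (Suc n) * (2 * \<bar>x\<bar>) ^ Suc n / fact (Suc n)) \<longlonglongrightarrow> 0"
        using LIMSEQ_Suc[OF summable_LIMSEQ_zero[OF sm[of "2 * \<bar>x\<bar>"]]] by simp
      have "norm (B (Suc n) * \<bar>x\<bar> ^ Suc n / fact n)
          \<le> B (Suc n) * (2 * \<bar>x\<bar>) ^ Suc n / fact (Suc n)" for n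
      proof -
        have B0: "B (Suc n) \<ge> 0" using bnd[of "Suc n" 0] norm_ge_zero order_trans by blast
        have "real (Suc n) \<le> 2 ^ Suc n"
          using less_exp[of "Suc n"] by (metis less_imp_le of_nat_le_iff of_nat_numeral of_nat_power)
        then have "B (Suc n) * \<bar>x\<bar> ^ Suc n * (real (Suc n)) \<le> B (Suc n) * \<bar>x\<bar> ^ Suc n * 2 ^ Suc n"
          using B0 by (intro mult_left_mono) auto
        then have "B (Suc n) * \<bar>x\<bar> ^ Suc n * real (Suc n) / fact (Suc n) \<le> B (Suc n) * \<bar>x\<bar> ^ Suc n * 2 ^ Suc n / fact (Suc n)"
          by (rule divide_right_mono) simp
        moreover have "B (Suc n) * \<bar>x\<bar> ^ Suc n * real (Suc n) / fact (Suc n) = B (Suc n) * \<bar>x\<bar> ^ Suc n / fact n"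
          by (simp add: field_simps del: of_nat_Suc)
        ultimately show ?thesis using B0 by (simp add: power_mult_distrib mult_ac)
      qed
      then show "\<forall>\<^sub>F n in sequentially. norm (B (Suc n) * \<bar>x\<bar> ^ Suc n / fact n)
          \<le> B (Suc n) * (2 * \<bar>x\<bar>) ^ Suc n / fact (Suc n)" by simp
    qed
    then have "(\<lambda>n. f 0 x - (\<Sum>i\<le>n. c 0 i * of_real x ^ i)) \<longlonglongrightarrow> 0"
      by (rule Lim_null_comparison[rotated]) (use rem in simp)
    then have "(\<lambda>n. (\<Sum>i\<le>n. c 0 i * of_real x ^ i)) \<longlonglongrightarrow> f 0 x"
      using LIM_zero_iff[of "\<lambda>n. (\<Sum>i\<le>n. c 0 i * of_real x ^ i)" "f 0 x"]
        tendsto_minus_cancel_left[of "\<lambda>n. f 0 x - (\<Sum>i\<le>n. c 0 i * of_real x ^ i)" 0] by simp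
    moreover have "(\<lambda>n. (\<Sum>i\<le>n. c 0 i * of_real x ^ i)) \<longlonglongrightarrow> P 0 (of_real x)"
      unfolding P_def using summable_LIMSEQ'[OF sum0] by simp
    ultimately show ?thesis using LIMSEQ_unique by blast
  qed
  have Pf: "P a (of_real x) = f a x" for a x
  proof (induction a arbitrary: x)
    case (Suc a)
    have "((\<lambda>x. P a (of_real x)) has_vector_derivative P (Suc a) (of_real x)) (at x)"
      by (rule has_vector_derivative_real_field[OF derP])
    then have "(f a has_vector_derivative P (Suc a) (of_real x)) (at x)"
      using Suc by simp
    then show ?case
      using der vector_derivative_unique_at by blast
  qed (rule Pf0)
  have hol: "P 0 holomorphic_on UNIV"
    using derP by (auto simp: holomorphic_on_def field_differentiable_def intro: DERIV_subset)
  have dP: "(deriv ^^ a) (P 0) = P a" for a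
    by (induction a) (auto intro!: ext DERIV_imp_deriv derP)
  show thesis
  proof (rule that[OF hol])
    fix x y :: real
    have "(\<lambda>n. (deriv ^^ n) (P 0) (of_real x) / fact n * (Complex x y - of_real x) ^ n) sums P 0 (Complex x y)"
      by (rule holomorphic_power_series[of _ _ "\<bar>y\<bar> + 1"])
        (auto simp: dist_norm intro!: holomorphic_on_subset[OF hol] simp: complex_norm cmod_def)
    moreover have "Complex x y - of_real x = \<i> * of_real y"
      by (simp add: complex_eq_iff)
    ultimately show "(\<lambda>a. f a x * (\<i> * of_real y) ^ a / fact a) sums P 0 (Complex x y)"
      by (simp add: dP Pf field_simps)
  qed
qed

text \<open>Taking \<open>b = a + 1\<close> in the decay bound makes the product of the growth of \<open>\<Phi>\<close> in one
  direction with its decay in the orthogonal one a series that converges exactly when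
  \<open>s + \<sigma> < 1\<close> (or when \<open>s + \<sigma> = 1\<close> and \<open>h\<close> is small). Hence \<open>\<Phi> w * \<Phi> (\<i> * w)\<close>
  tends to \<open>0\<close> at infinity.\<close>

lemma rapidly_decaying_entire_eq_0:
  fixes f :: "nat \<Rightarrow> real \<Rightarrow> complex" and C h s \<sigma> :: real
  assumes der: "\<And>a x. (f a has_vector_derivative f (Suc a) x) (at x)"
    and C: "C > 0" and h: "h > 0"
    and bnd: "\<And>a x. norm (f a x) \<le> C * h ^ a * fact a powr \<sigma>"
    and dec: "\<And>a b x. \<bar>x\<bar> \<ge> 1 \<Longrightarrow>
      \<bar>x\<bar> ^ b * norm (f a x) \<le> C * h ^ (a + b) * fact a powr \<sigma> * fact b powr s"
    and smA: "\<And>r. 0 \<le> r \<Longrightarrow> summable (\<lambda>a. fact a powr \<sigma> * r ^ a / fact a)"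
    and smS: "summable (\<lambda>a. h ^ (2 * a + 1) * fact a powr \<sigma> * fact (Suc a) powr s / fact a)"
  shows "f 0 0 = 0"
proof -
  \<comment> \<open>Up to the constant \<open>C\<close>, \<open>A\<close> majorises the growth of
    the extension in the imaginary direction and \<open>\<omega>\<close> is the best decay that
    \<open>dec\<close> yields over all \<open>b\<close>. On \<open>\<bar>x\<bar> < 1\<close> the
    value \<open>1\<close> matches \<open>bnd\<close>. \<open>\<psi>\<close> sets growth against
    decay at the same real number.\<close>
  define A where "A = (\<lambda>r. \<Sum>a. fact a powr \<sigma> * r ^ a / fact a)"
  define T where "T = (\<Sum>a. h ^ (2 * a + 1) * fact a powr \<sigma> * fact (Suc a) powr s / fact a)"
  define \<omega> where "\<omega> = (\<lambda>x::real. if \<bar>x\<bar> < 1 then 1 else INF b. h ^ b * fact b powr s / \<bar>x\<bar> ^ b)"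
  define \<psi> where "\<psi> = (\<lambda>x. A (h * \<bar>x\<bar>) * \<omega> x)"
  have bddb: "bdd_below (range (\<lambda>b. h ^ b * fact b powr s / \<bar>x\<bar> ^ b))" for x :: real
    using h by (intro bdd_belowI[of _ 0]) auto
  have \<omega>0: "0 \<le> \<omega> x" for x
    using h by (auto simp: \<omega>_def intro!: cINF_greatest)
  have \<omega>_le: "\<omega> x \<le> h ^ b * fact b powr s / \<bar>x\<bar> ^ b" if "\<bar>x\<bar> \<ge> 1" for x b
    using that bddb by (auto simp: \<omega>_def intro!: cINF_lower)
  have A0: "0 \<le> A r" if "0 \<le> r" for r
    unfolding A_def using that smA by (intro suminf_nonneg) auto
  have f_le: "norm (f a x) \<le> C * h ^ a * fact a powr \<sigma> * \<omega> x" for a x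
  proof (cases "\<bar>x\<bar> < 1")
    case True
    then show ?thesis using bnd[of a x] by (simp add: \<omega>_def)
  next
    case False
    have pos: "C * h ^ a * fact a powr \<sigma> > 0" using C h by simp
    have "norm (f a x) / (C * h ^ a * fact a powr \<sigma>) \<le> (INF b. h ^ b * fact b powr s / \<bar>x\<bar> ^ b)"
    proof (rule cINF_greatest)
      fix b
      have "norm (f a x) \<le> (C * h ^ a * fact a powr \<sigma>) * (h ^ b * fact b powr s / \<bar>x\<bar> ^ b)"
        using dec[of x b a] False by (simp add: field_simps power_add)
      then show "norm (f a x) / (C * h ^ a * fact a powr \<sigma>) \<le> h ^ b * fact b powr s / \<bar>x\<bar> ^ b"
        using pos by (simp add: pos_divide_le_eq mult.commute)
    qed simp
    then show ?thesis using pos False by (simp add: \<omega>_def pos_divide_le_eq mult.commute)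
  qed
  have T0: "0 \<le> T" unfolding T_def using h smS by (intro suminf_nonneg) auto
  have \<psi>0: "0 \<le> \<psi> x" for x
    unfolding \<psi>_def using A0 \<omega>0 h by simp
  \<comment> \<open>In the \<open>a\<close>-th term of \<open>A\<close> the infimum
    \<open>\<omega> x\<close> is replaced by its member \<open>b = Suc a\<close>; all powers of
    \<open>\<bar>x\<bar>\<close> cancel except one in the denominator.\<close>
  have \<psi>_large: "\<psi> x \<le> T / \<bar>x\<bar>" if x: "\<bar>x\<bar> \<ge> 1" for x
  proof -
    have "\<psi> x = (\<Sum>a. fact a powr \<sigma> * (h * \<bar>x\<bar>) ^ a / fact a * \<omega> x)"
      unfolding \<psi>_def A_def using h by (intro suminf_mult2 smA) simp
    also have "\<dots> \<le> (\<Sum>a. h ^ (2 * a + 1) * fact a powr \<sigma> * fact (Suc a) powr s / fact a * (1 / \<bar>x\<bar>))"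
    proof (intro suminf_le summable_mult2 smA smS)
      fix a
      have "fact a powr \<sigma> * (h * \<bar>x\<bar>) ^ a / fact a * \<omega> x
        \<le> fact a powr \<sigma> * (h * \<bar>x\<bar>) ^ a / fact a * (h ^ Suc a * fact (Suc a) powr s / \<bar>x\<bar> ^ Suc a)"
        using h by (intro mult_left_mono \<omega>_le x) auto
      also have "\<dots> = h ^ (2 * a + 1) * fact a powr \<sigma> * fact (Suc a) powr s / fact a * (1 / \<bar>x\<bar>)"
      proof -
        have "h ^ (2 * a + 1) = h ^ a * h ^ Suc a" by (simp add: mult_2 flip: power_add)
        moreover have "x \<noteq> 0" using x by auto
        ultimately show ?thesis
          by (simp only: power_mult_distrib) (simp add: field_simps del: fact_Suc)
      qed
      finally show "fact a powr \<sigma> * (h * \<bar>x\<bar>) ^ a / fact a * \<omega> x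
        \<le> h ^ (2 * a + 1) * fact a powr \<sigma> * fact (Suc a) powr s / fact a * (1 / \<bar>x\<bar>)" .
    qed (use h in simp)
    also have "\<dots> = T * (1 / \<bar>x\<bar>)"
      unfolding T_def by (rule suminf_mult2[symmetric, OF smS])
    finally show ?thesis by simp
  qed
  define D where "D = A h + T"
  have \<psi>_le: "\<psi> x \<le> D" for x
  proof (cases "\<bar>x\<bar> < 1")
    case True
    have "A (h * \<bar>x\<bar>) \<le> A h"
      unfolding A_def using True h
      by (intro suminf_le smA divide_right_mono mult_left_mono power_mono) (auto simp: mult_le_cancel_left1)
    then show ?thesis using True T0 by (simp add: \<psi>_def \<omega>_def D_def)
  next
    case False
    then have "T / \<bar>x\<bar> \<le> T" using T0 by (simp add: divide_le_eq mult_le_cancel_left1)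
    then show ?thesis using False \<psi>_large[of x] A0[of h] h by (simp add: D_def)
  qed
  have D0: "0 \<le> D" using \<psi>0 \<psi>_le order_trans by blast
  have smB: "summable (\<lambda>a. C * h ^ a * fact a powr \<sigma> * r ^ a / fact a)" if "0 \<le> r" for r
    using summable_mult[OF smA[of "h * r"], of C] that h by (simp add: power_mult_distrib mult_ac)
  obtain \<Phi> where hol: "\<Phi> holomorphic_on UNIV"
    and sums: "\<And>x y. (\<lambda>a. f a x * (\<i> * of_real y) ^ a / fact a) sums \<Phi> (Complex x y)"
    using entire_extension[of f, OF der bnd smB] by metis
  have \<Phi>_le: "norm (\<Phi> (Complex x y)) \<le> C * (A (h * \<bar>y\<bar>) * \<omega> x)" for x y
  proof -
    have le: "norm (f a x * (\<i> * of_real y) ^ a / fact a)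
        \<le> C * (fact a powr \<sigma> * (h * \<bar>y\<bar>) ^ a / fact a * \<omega> x)" for a
    proof -
      have "norm (f a x) * \<bar>y\<bar> ^ a \<le> C * h ^ a * fact a powr \<sigma> * \<omega> x * \<bar>y\<bar> ^ a"
        by (intro mult_right_mono f_le) simp
      then show ?thesis
        by (simp add: norm_mult norm_divide norm_power power_mult_distrib divide_le_cancel mult_ac)
    qed
    have sm: "summable (\<lambda>a. C * (fact a powr \<sigma> * (h * \<bar>y\<bar>) ^ a / fact a * \<omega> x))"
      using h by (intro summable_mult summable_mult2 smA) simp
    have "norm (\<Phi> (Complex x y)) \<le> (\<Sum>a. C * (fact a powr \<sigma> * (h * \<bar>y\<bar>) ^ a / fact a * \<omega> x))"
      using norm_suminf_le[OF le sm] sums[of x y, unfolded sums_iff] by simp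
    also have "\<dots> = C * (\<Sum>a. fact a powr \<sigma> * (h * \<bar>y\<bar>) ^ a / fact a * \<omega> x)"
      using h by (intro suminf_mult summable_mult2 smA) simp
    also have "\<dots> = C * (A (h * \<bar>y\<bar>) * \<omega> x)"
      unfolding A_def using h by (subst suminf_mult2[OF smA]) simp_all
    finally show ?thesis .
  qed
  \<comment> \<open>Since \<open>\<i> * z\<close> is \<open>Complex (- y) x\<close>, the growth in
    \<open>y\<close> of one factor meets the decay in \<open>y\<close> of the other, and likewise
    for \<open>x\<close>. The product is bounded by a multiple of
    \<open>\<psi> x * \<psi> y\<close>.\<close>
  define \<Psi> where "\<Psi> = (\<lambda>z. \<Phi> z * \<Phi> (\<i> * z))"
  have \<Psi>_le: "norm (\<Psi> z) \<le> 2 * C\<^sup>2 * D * T / norm z" if z: "norm z \<ge> 2" for z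
  proof -
    obtain x y where zxy: "z = Complex x y" by (cases z)
    have iz: "\<i> * z = Complex (- y) x" by (simp add: zxy complex_eq_iff)
    have "norm (\<Psi> z) \<le> (C * (A (h * \<bar>y\<bar>) * \<omega> x)) * (C * (A (h * \<bar>x\<bar>) * \<omega> (- y)))"
      unfolding \<Psi>_def norm_mult iz using \<Phi>_le[of x y] \<Phi>_le[of "- y" x] zxy
      by (intro mult_mono) (auto intro: order_trans[OF norm_ge_zero])
    also have "\<dots> = C\<^sup>2 * (\<psi> x * \<psi> y)"
      by (simp add: \<psi>_def \<omega>_def power2_eq_square mult_ac)
    \<comment> \<open>One of \<open>\<bar>x\<bar>\<close>, \<open>\<bar>y\<bar>\<close> is at least
      \<open>norm z / 2\<close>, hence at least \<open>1\<close>, and \<open>\<psi>\<close> decays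
      there; at the other coordinate the bound \<open>D\<close> is used.\<close>
    also have "\<psi> x * \<psi> y \<le> D * (T * 2 / norm z)"
    proof -
      have split: "norm z \<le> \<bar>x\<bar> + \<bar>y\<bar>" using cmod_le[of z] zxy by simp
      have *: "T / \<bar>w\<bar> \<le> T * 2 / norm z" if "\<bar>w\<bar> \<ge> norm z / 2" for w
      proof -
        have "T / \<bar>w\<bar> \<le> T / (norm z / 2)" using that z T0 by (intro divide_left_mono mult_pos_pos) auto
        then show ?thesis by (simp add: mult_ac)
      qed
      consider "\<bar>x\<bar> \<ge> norm z / 2" | "\<bar>y\<bar> \<ge> norm z / 2" using split by linarith
      then show ?thesis
      proof cases
        case 1
        then have "\<psi> x \<le> T * 2 / norm z" using \<psi>_large[of x] *[of x] z by linarith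
        then have "\<psi> y * \<psi> x \<le> D * (T * 2 / norm z)" using \<psi>_le \<psi>0 D0 by (intro mult_mono)
        then show ?thesis by (simp add: mult.commute)
      next
        case 2
        then have "\<psi> y \<le> T * 2 / norm z" using \<psi>_large[of y] *[of y] z by linarith
        then show ?thesis using \<psi>_le \<psi>0 D0 by (intro mult_mono)
      qed
    qed
    finally show ?thesis using C by (simp add: mult_ac)
  qed
  have "(\<Psi> \<longlongrightarrow> 0) at_infinity"
  proof (rule Lim_null_comparison)
    show "\<forall>\<^sub>F z in at_infinity. norm (\<Psi> z) \<le> 2 * C\<^sup>2 * D * T / norm z"
      unfolding eventually_at_infinity using \<Psi>_le by auto
    show "((\<lambda>z. 2 * C\<^sup>2 * D * T / norm (z::complex)) \<longlongrightarrow> 0) at_infinity"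
      by (rule tendsto_divide_0[OF tendsto_const]) 
        (simp add: filterlim_norm_at_top filterlim_at_top_imp_at_infinity)
  qed
  moreover have "\<Psi> holomorphic_on UNIV"
    unfolding \<Psi>_def using holomorphic_on_compose_gen[of "\<lambda>z. \<i> * z" UNIV \<Phi> UNIV] hol
    by (auto intro!: holomorphic_intros simp: o_def)
  ultimately have "\<Psi> 0 = 0" using Liouville_weak by blast
  then have "\<Phi> 0 = 0" by (simp add: \<Psi>_def)
  moreover have "(\<lambda>a. f a 0 * (\<i> * of_real 0) ^ a / fact a) sums (f 0 0)"
    using powser_sums_zero[of "\<lambda>a. f a 0 / fact a"] by simp
  moreover have "Complex 0 0 = 0" by (simp add: complex_eq_iff)
  ultimately show ?thesis using sums_unique2[OF _ sums[of 0 0]] by metis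
qed

section \<open>Uniqueness of Fourier coefficients\<close>

text \<open>\<open>Arg2pi\<close> jumps across the positive real axis, and \<open>h 0 = h 1\<close>
  closes the gap. Continuity is read off from the trivial homotopy of the loop \<open>h\<close> to
  itself, transferred to maps on the circle.\<close>

lemma continuous_on_circle_of_periodic:
  fixes h :: "real \<Rightarrow> 'a::real_normed_vector"
  assumes "continuous_on {0..1} h" "h 0 = h 1"
  shows "continuous_on (sphere 0 1) (\<lambda>z. h (Arg2pi z / (2 * pi)))"
proof -
  have "homotopic_loops UNIV h h"
    using assms by (simp add: homotopic_loops_refl path_def pathstart_def pathfinish_def)
  from homotopic_with_imp_continuous[OF homotopic_loops_imp_homotopic_circlemaps[OF this]]
  show ?thesis by (simp add: o_def)
qed

text \<open>The functions that multiply the space \<open>Z\<close> of continuous functions with vanishing Fourier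
  coefficients into itself are closed under products and contain the coordinate functions of the
  circle, hence all polynomials; Stone--Weierstrass then gives \<open>\<integral> \<bar>h\<bar>\<^sup>2 = 0\<close>.\<close>

lemma periodic_eq_0_if_Fourier_coeffs_0:
  fixes h :: "real \<Rightarrow> complex"
  assumes cont: "continuous_on {0..1} h" and per: "h 0 = h 1"
    and coeff: "\<And>k::int. integral {0..1} (\<lambda>t. exp (2 * pi * \<i> * k * t) * h t) = 0"
    and t: "t \<in> {0..1}"
  shows "h t = 0"
proof -
  define e :: "int \<Rightarrow> real \<Rightarrow> complex" where "e = (\<lambda>k t. exp (2 * pi * \<i> * k * t))"
  define Z where "Z = {h. continuous_on {0..1} h \<and> (\<forall>k. integral {0..1} (\<lambda>t. e k t * h t) = 0)}"
  have conte [continuous_intros]: "continuous_on S (e k)" for S k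
    unfolding e_def by (intro continuous_intros)
  have e_mult: "e k t * e m t = e (k + m) t" for k m t
    by (simp add: e_def exp_add[symmetric] algebra_simps)
  have e_cnj: "cnj (e k t) = e (- k) t" for k t
    by (simp add: e_def exp_cnj)
  have e_1: "e 1 t = exp (2 * pi * \<i> * t)" for t
    by (simp add: e_def)
  have norm_e [simp]: "norm (e k t) = 1" for k t
    by (simp add: e_def)
  have poly_Z: "\<forall>h\<in>Z. (\<lambda>t. of_real (p (e 1 t)) * h t) \<in> Z"
    if "real_polynomial_function p" for p :: "complex \<Rightarrow> real"
    using that
  proof (induction p rule: real_polynomial_function.induct)
    case (linear p)
    \<comment> \<open>A real-linear functional on the plane is
      \<open>\<alpha> * z + cnj \<alpha> * cnj z\<close>. On the circle, multiplication by it shifts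
      the Fourier index by \<open>1\<close> and by \<open>-1\<close>, and \<open>Z\<close> asks for
      vanishing at every index.\<close>
    define \<alpha> where "\<alpha> = Complex (p 1 / 2) (- p \<i> / 2)"
    have lin: "linear p" using linear by (rule bounded_linear.linear)
    have pz: "p z = Re z * p 1 + Im z * p \<i>" for z
    proof -
      have "p z = p (Re z *\<^sub>R 1 + Im z *\<^sub>R \<i>)" by (rule arg_cong[of _ _ p]) (simp add: complex_eq_iff)
      then show ?thesis using lin by (simp add: linear_add linear_scale)
    qed
    have p: "of_real (p z) = \<alpha> * z + cnj \<alpha> * cnj z" for z
      unfolding pz[of z] by (simp add: complex_eq_iff \<alpha>_def field_simps)
    show ?case
    proof
      fix h assume h: "h \<in> Z"
      then have ch: "continuous_on {0..1} h" by (simp add: Z_def)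
      have "integral {0..1} (\<lambda>t. e k t * (of_real (p (e 1 t)) * h t)) = 0" for k
      proof -
        have "(\<lambda>t. e k t * (of_real (p (e 1 t)) * h t)) =
          (\<lambda>t. \<alpha> * (e (k + 1) t * h t) + cnj \<alpha> * (e (k - 1) t * h t))"
        proof
          fix t
          have "e (k + 1) t = e k t * e 1 t" "e (k - 1) t = e k t * e (- 1) t"
            by (simp_all add: e_mult)
          then show "e k t * (of_real (p (e 1 t)) * h t) =
              \<alpha> * (e (k + 1) t * h t) + cnj \<alpha> * (e (k - 1) t * h t)"
            by (simp add: p e_cnj algebra_simps)
        qed
        moreover have "integral {0..1} \<dots> = 0"
          using h by (subst integral_add)
            (auto intro!: integrable_continuous_real continuous_intros ch simp: Z_def)
        ultimately show ?thesis by simp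
      qed
      moreover have "continuous_on {0..1} (\<lambda>t. of_real (p (e 1 t)) * h t)"
        by (intro continuous_intros ch bounded_linear.continuous_on[OF linear])
      ultimately show "(\<lambda>t. of_real (p (e 1 t)) * h t) \<in> Z" by (simp add: Z_def)
    qed
  next
    case (const c)
    show ?case by (auto simp: Z_def mult.left_commute[of _ "of_real c"] intro!: continuous_intros)
  next
    case (add p q)
    show ?case
    proof
      fix h assume "h \<in> Z"
      with add have "(\<lambda>t. of_real (p (e 1 t)) * h t) \<in> Z" "(\<lambda>t. of_real (q (e 1 t)) * h t) \<in> Z"
        by auto
      then have *: "continuous_on {0..1} (\<lambda>t. of_real (p (e 1 t)) * h t)"
          "continuous_on {0..1} (\<lambda>t. of_real (q (e 1 t)) * h t)"
          "\<And>k. integral {0..1} (\<lambda>t. e k t * (of_real (p (e 1 t)) * h t)) = 0"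
          "\<And>k. integral {0..1} (\<lambda>t. e k t * (of_real (q (e 1 t)) * h t)) = 0"
        by (simp_all add: Z_def)
      have "integral {0..1} (\<lambda>t. e k t * (of_real (p (e 1 t)) * h t)
          + e k t * (of_real (q (e 1 t)) * h t)) = 0" for k
        by (subst integral_add) (intro integrable_continuous_real continuous_intros * | simp add: *)+
      moreover have "continuous_on {0..1} (\<lambda>t. of_real (p (e 1 t)) * h t + of_real (q (e 1 t)) * h t)"
        by (intro continuous_on_add *)
      ultimately show "(\<lambda>t. of_real (p (e 1 t) + q (e 1 t)) * h t) \<in> Z"
        by (simp add: Z_def ring_distribs)
    qed
  next
    case (mult p q)
    then show ?case by (auto simp: mult.assoc)
  qed
  have hZ: "h \<in> Z" using cont coeff by (simp add: Z_def e_def)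
  have poly0: "integral {0..1} (\<lambda>t. g (e 1 t) * h t) = 0" and poly_int: "(\<lambda>t. g (e 1 t) * h t) integrable_on {0..1}"
    if g: "polynomial_function g" for g :: "complex \<Rightarrow> complex"
  proof -
    have "real_polynomial_function (\<lambda>z. Re (g z))" "real_polynomial_function (\<lambda>z. Im (g z))"
      using g bounded_linear_Re bounded_linear_Im by (auto simp: polynomial_function_def o_def)
    then have Z: "(\<lambda>t. of_real (Re (g (e 1 t))) * h t) \<in> Z" "(\<lambda>t. of_real (Im (g (e 1 t))) * h t) \<in> Z"
      using poly_Z hZ by blast+
    have e0: "e 0 t = 1" for t by (simp add: e_def)
    have I: "integral {0..1} (\<lambda>t. of_real (Re (g (e 1 t))) * h t) = 0"
       "integral {0..1} (\<lambda>t. of_real (Im (g (e 1 t))) * h t) = 0"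
      using Z by (auto simp: Z_def e0 dest: spec[of _ 0])
    have eq: "(\<lambda>t. g (e 1 t) * h t) = (\<lambda>t. of_real (Re (g (e 1 t))) * h t + \<i> * (of_real (Im (g (e 1 t))) * h t))"
    proof
      fix t show "g (e 1 t) * h t = of_real (Re (g (e 1 t))) * h t + \<i> * (of_real (Im (g (e 1 t))) * h t)"
        by (subst complex_eq[of "g (e 1 t)"]) (simp add: ring_distribs mult.assoc)
    qed
    show "integral {0..1} (\<lambda>t. g (e 1 t) * h t) = 0"
      unfolding eq using Z I by (subst integral_add)
        (auto simp: Z_def intro!: integrable_continuous_real continuous_intros)
    show "(\<lambda>t. g (e 1 t) * h t) integrable_on {0..1}"
      unfolding eq using Z by (auto simp: Z_def intro!: integrable_continuous_real continuous_intros)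
  qed
  have contH: "continuous_on (sphere 0 1) (\<lambda>z. cnj (h (Arg2pi z / (2 * pi))))"
    using continuous_on_circle_of_periodic[OF cont per] by (intro continuous_intros)
  \<comment> \<open>At \<open>t = 1\<close> the angle of \<open>e 1 t\<close> is \<open>0\<close>,
    not \<open>2 * pi\<close>, so this endpoint rests on \<open>per\<close>.\<close>
  have He: "h (Arg2pi (e 1 t) / (2 * pi)) = h t" if "t \<in> {0..1}" for t
  proof (cases "t = 1")
    case True
    then have "e 1 t = 1" by (simp add: e_1 exp_two_pi_i)
    then show ?thesis using per True Arg2pi_eq_0[of 1] by simp
  next
    case False
    then have "Arg2pi (e 1 t) = 2 * pi * t"
      using that by (intro Arg2pi_unique[of 1]) (auto simp: e_1 mult_ac)
    then show ?thesis by simp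
  qed
  have "bounded (h ` {0..1})"
    by (intro compact_imp_bounded compact_continuous_image cont compact_Icc)
  then obtain M where M0: "0 < M" and "\<forall>x\<in>h ` {0..1}. norm x \<le> M"
    unfolding bounded_pos by blast
  then have M: "norm (h t) \<le> M" if "t \<in> {0..1}" for t
    using that by blast
  let ?I = "integral {0..1} (\<lambda>t. cnj (h t) * h t)"
  have intI: "(\<lambda>t. cnj (h t) * h t) integrable_on {0..1}"
    by (intro integrable_continuous_real continuous_intros cont)
  have small: "norm ?I \<le> \<epsilon> * M" if eps: "\<epsilon> > 0" for \<epsilon>
  proof -
    \<comment> \<open>\<open>g\<close> approximates \<open>cnj h\<close> transported to the circle.
      As \<open>g (e 1 t) * h t\<close> has integral \<open>0\<close>, it may be subtracted from the
      integrand, which leaves only the approximation error times \<open>h\<close>.\<close>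
    obtain g where g: "polynomial_function g"
      "\<And>z. z \<in> sphere 0 1 \<Longrightarrow> norm (cnj (h (Arg2pi z / (2 * pi))) - g z) < \<epsilon>"
      using Stone_Weierstrass_polynomial_function[OF _ contH eps] by auto
    have "?I = integral {0..1} (\<lambda>t. cnj (h t) * h t - g (e 1 t) * h t)"
      using poly0[OF g(1)] poly_int[OF g(1)] intI by (subst integral_diff) auto
    also have "norm \<dots> \<le> (\<epsilon> * M) * measure lborel (cbox 0 (1::real))"
    proof (rule has_integral_bound)
      show "0 \<le> \<epsilon> * M" using M0 eps by simp
      show "((\<lambda>t. cnj (h t) * h t - g (e 1 t) * h t) has_integral
          integral {0..1} (\<lambda>t. cnj (h t) * h t - g (e 1 t) * h t)) (cbox 0 1)"
        using integrable_integral[OF integrable_diff[OF intI poly_int[OF g(1)]]] by simp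
      fix t :: real assume "t \<in> cbox 0 1"
      then have t: "t \<in> {0..1}" by simp
      have "norm (cnj (h t) - g (e 1 t)) \<le> \<epsilon>"
        using g(2)[of "e 1 t"] He[OF t] by simp
      then show "norm (cnj (h t) * h t - g (e 1 t) * h t) \<le> \<epsilon> * M"
        unfolding left_diff_distrib[symmetric] norm_mult
        using M[OF t] eps by (intro mult_mono) auto
    qed
    finally show ?thesis by simp
  qed
  have "?I = 0"
  proof (rule ccontr)
    assume "?I \<noteq> 0"
    moreover define N where "N = norm ?I"
    ultimately have "N > 0" by simp
    \<comment> \<open>This choice of \<open>\<epsilon>\<close> makes \<open>\<epsilon> * M\<close>
      smaller than \<open>N / 2\<close>.\<close>
    then have "N \<le> N / (2 * (M + 1)) * M"
      unfolding N_def using M0 by (intro small) simp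
    also have "\<dots> < N"
      using \<open>N > 0\<close> M0 by (simp add: field_simps add_pos_pos)
    finally show False by simp
  qed
  then have "((\<lambda>t. cnj (h t) * h t) has_integral 0) {0..1}"
    using intI by (simp add: has_integral_integral)
  from has_integral_linear[OF this bounded_linear_Re]
  moreover have "Re \<circ> (\<lambda>t. cnj (h t) * h t) = (\<lambda>t. (norm (h t))\<^sup>2)"
    unfolding cmod_power2 by (simp add: o_def power2_eq_square)
  ultimately have "((\<lambda>t. (norm (h t))\<^sup>2) has_integral 0) (cbox 0 1)"
    by simp
  then have "(norm (h t))\<^sup>2 = 0"
    using t cont by (intro has_integral_0_cbox_imp_0[of 0 1 "\<lambda>t. (norm (h t))\<^sup>2"])
      (auto intro!: continuous_intros)
  then show ?thesis by simp
qed

section \<open>Vanishing of quasi-periodic functions\<close>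

text \<open>For positive \<open>\<theta>\<close> the quotient of consecutive terms is
  \<open>r * real (Suc n) powr - \<theta>\<close>, which tends to \<open>0\<close>; for
  \<open>\<theta> = 0\<close> the series is geometric. With
  \<open>\<theta> = 1 - (s + \<sigma>)\<close> these are the subcritical and the critical
  case.\<close>

lemma summable_power_times_fact_powr:
  fixes r \<theta> :: real
  assumes r: "0 \<le> r" and \<theta>: "\<theta> > 0 \<or> \<theta> = 0 \<and> r < 1"
  shows "summable (\<lambda>n. r ^ n * fact n powr - \<theta>)"
proof (cases "\<theta> > 0")
  case True
  have "((\<lambda>n. r * real (Suc n) powr - \<theta>) \<longlongrightarrow> r * 0) sequentially"
    using True by (intro tendsto_intros tendsto_neg_powr filterlim_compose[OF filterlim_real_sequentially filterlim_Suc]) simp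
  then have "\<forall>\<^sub>F n in sequentially. r * real (Suc n) powr - \<theta> < 1 / 2"
    by (rule order_tendstoD) simp
  then obtain N where N: "\<And>n. n \<ge> N \<Longrightarrow> r * real (Suc n) powr - \<theta> < 1 / 2"
    by (auto simp: eventually_sequentially)
  show ?thesis
  proof (rule summable_ratio_test[of "1 / 2" N])
    fix n assume n: "N \<le> n"
    have "r ^ Suc n * fact (Suc n) powr - \<theta> = (r * real (Suc n) powr - \<theta>) * (r ^ n * fact n powr - \<theta>)"
      by (simp add: powr_mult mult_ac del: of_nat_Suc)
    also have "\<dots> \<le> 1 / 2 * (r ^ n * fact n powr - \<theta>)"
      using N[OF n] r by (intro mult_right_mono) auto
    finally show "norm (r ^ Suc n * fact (Suc n) powr - \<theta>) \<le> 1 / 2 * norm (r ^ n * fact n powr - \<theta>)"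
      using r by simp
  qed simp
next
  case False
  then show ?thesis using assms by (simp add: summable_geometric)
qed

lemma fact_powr_divide_fact: "fact a powr t / fact a = (fact a :: real) powr - (1 - t)"
  using powr_diff[of "fact a :: real" t 1] by simp

section \<open>Fourier coefficients along a line\<close>

lemma has_vector_derivative_shift:
  assumes "(f has_vector_derivative f') (at (t + c))"
  shows "((\<lambda>t. f (t + c)) has_vector_derivative f') (at t)"
proof -
  have "((\<lambda>t. t + c) has_vector_derivative 1) (at t)"
    by (auto simp: has_vector_derivative_def intro!: derivative_eq_intros)
  from vector_diff_chain_at[OF this assms] show ?thesis by (simp add: o_def)
qed

text \<open>Integration by parts: \<open>g b\<close> and the exponential take equal values at both
  ends, so the boundary terms cancel and each step trades a factor \<open>2 * pi * \<i> * k\<close>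
  for one derivative, up to sign.\<close>

lemma periodic_Fourier_coeff_bound:
  fixes g :: "nat \<Rightarrow> real \<Rightarrow> complex" and k :: int
  assumes der: "\<And>b u. (g b has_vector_derivative g (Suc b) u) (at u)"
    and per: "\<And>b. g b 1 = g b 0"
    and bnd: "\<And>u. u \<in> {0..1} \<Longrightarrow> norm (g b u) \<le> M"
  shows "\<bar>2 * pi * k\<bar> ^ b * norm (integral {0..1} (\<lambda>u. exp (2 * pi * \<i> * k * u) * g 0 u)) \<le> M"
proof -
  let ?e = "\<lambda>u::real. exp (2 * pi * \<i> * k * u)"
  let ?J = "\<lambda>b. integral {0..1} (\<lambda>u. ?e u * g b u)"
  have cont: "continuous_on {0..1} (g b)" for b
    using der by (meson continuous_at_imp_continuous_on has_vector_derivative_continuous)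
  have int: "(\<lambda>u. ?e u * g b u) integrable_on {0..1}" for b
    by (intro integrable_continuous_real continuous_intros cont)
  have rec: "?J (Suc b) = - (2 * pi * \<i> * k) * ?J b" for b
  proof -
    have "((\<lambda>u. 2 * pi * \<i> * k * (?e u * g b u) + ?e u * g (Suc b) u) has_integral ?e 1 * g b 1 - ?e 0 * g b 0) {0..1}"
    proof (rule fundamental_theorem_of_calculus)
      fix u :: real
      have "((\<lambda>z. exp (2 * pi * \<i> * k * z)) has_field_derivative 2 * pi * \<i> * k * exp (2 * pi * \<i> * k * u)) (at (of_real u))"
        by (auto intro!: derivative_eq_intros)
      then have "(?e has_vector_derivative 2 * pi * \<i> * k * ?e u) (at u)"
        by (rule has_vector_derivative_real_field)
      from has_vector_derivative_at_within[OF has_vector_derivative_mult[OF this der[of b u]]]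
      show "((\<lambda>u. ?e u * g b u) has_vector_derivative 2 * pi * \<i> * k * (?e u * g b u) + ?e u * g (Suc b) u) (at u within {0..1})"
        by (simp add: algebra_simps)
    qed simp
    moreover have "?e 1 = 1"
      using exp_integer_2pi[of "of_int k"] by (simp add: mult_ac)
    ultimately have "((\<lambda>u. 2 * pi * \<i> * k * (?e u * g b u) + ?e u * g (Suc b) u) has_integral 0) {0..1}"
      by (simp add: per)
    then have "integral {0..1} (\<lambda>u. 2 * pi * \<i> * k * (?e u * g b u) + ?e u * g (Suc b) u) = 0"
      by (rule integral_unique)
    then have "2 * pi * \<i> * k * ?J b + ?J (Suc b) = 0"
      using int by (subst (asm) integral_add) (auto intro!: integrable_on_mult_right)
    then show ?thesis by (simp add: add_eq_0_iff)
  qed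
  have J: "\<bar>2 * pi * k\<bar> ^ b * norm (?J 0) = norm (?J b)" for b
  proof (induction b)
    case (Suc b)
    have "norm (?J (Suc b)) = \<bar>2 * pi * k\<bar> * norm (?J b)"
      unfolding rec norm_mult by (simp add: norm_mult abs_mult)
    then show ?case using Suc by (simp add: mult.assoc)
  qed simp
  have "norm (?J b) \<le> M * (1 - 0)"
  proof (rule integral_bound)
    fix u :: real assume "u \<in> {0..1}"
    then show "norm (?e u * g b u) \<le> M" using bnd by (simp add: norm_mult)
  qed (auto intro!: continuous_intros cont)
  then show ?thesis unfolding J by simp
qed

text \<open>\<open>g a b\<close> plays the role of the mixed derivative of order \<open>a\<close> in
  \<open>t\<close> and \<open>b\<close> in \<open>u\<close>. Quasi-periodicity turns the mean at
  \<open>t + k\<close> into a Fourier coefficient at \<open>t\<close>, so bounds on the unit square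
  control the mean and its derivatives on the whole line.\<close>

lemma Zak_line_mean_eq_0:
  fixes g :: "nat \<Rightarrow> nat \<Rightarrow> real \<Rightarrow> real \<Rightarrow> complex" and C H s \<sigma> :: real
  assumes dt: "\<And>a b t u. ((\<lambda>t. g a b t u) has_vector_derivative g (Suc a) b t u) (at t)"
    and du: "\<And>a b t u. (g a b t has_vector_derivative g a (Suc b) t u) (at u)"
    and cont: "\<And>a b. continuous_on UNIV (\<lambda>(t, u). g a b t u)"
    and quasi: "\<And>(t::real) u (k::int). g 0 0 (t + k) u = exp (2 * pi * \<i> * k * u) * g 0 0 t u"
    and per: "\<And>t u. g 0 0 t (u + 1) = g 0 0 t u"
    and bnd: "\<And>a b t u. t \<in> {0..1} \<Longrightarrow> u \<in> {0..1} \<Longrightarrow>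
      norm (g a b t u) \<le> C * H ^ (a + b) * fact a powr \<sigma> * fact b powr s"
    and C: "C > 0" and H: "H > 0" and s: "s > 0" and \<sigma>: "\<sigma> > 0"
    and cond: "s + \<sigma> < 1 \<or> s + \<sigma> = 1 \<and> 2 * H\<^sup>2 < 1"
  shows "integral {0..1} (g 0 0 0) = 0"
proof -
  define f where "f = (\<lambda>a t. integral {0..1} (g a 0 t))"
  \<comment> \<open>The multiplier is constant in \<open>t\<close>, so the relation passes to all
    \<open>t\<close>-derivatives. The \<open>u\<close>-derivatives enter only for \<open>t\<close>
    in the unit interval, through the periodicity \<open>per'\<close>.\<close>
  have quasi': "g a 0 (t + of_int k) u = exp (2 * pi * \<i> * k * u) * g a 0 t u" for a t u and k :: int
  proof (induction a arbitrary: t)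
    case (Suc a)
    have "((\<lambda>t. g a 0 (t + of_int k) u) has_vector_derivative g (Suc a) 0 (t + of_int k) u) (at t)"
      by (rule has_vector_derivative_shift[OF dt])
    moreover have "((\<lambda>t. exp (2 * pi * \<i> * k * u) * g a 0 t u) has_vector_derivative
        exp (2 * pi * \<i> * k * u) * g (Suc a) 0 t u) (at t)"
      by (intro has_vector_derivative_mult_right dt)
    ultimately show ?case using Suc vector_derivative_unique_at by fastforce
  qed (simp add: quasi)
  have per0: "g a 0 t (u + 1) = g a 0 t u" for a t u
  proof (induction a arbitrary: t)
    case (Suc a)
    then show ?case using dt[of a 0 "u + 1" t] dt[of a 0 u t] vector_derivative_unique_at by force
  qed (simp add: per)
  have per': "g a b t (u + 1) = g a b t u" for a b t u
  proof (induction b arbitrary: u)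
    case (Suc b)
    have "((\<lambda>u. g a b t (u + 1)) has_vector_derivative g a (Suc b) t (u + 1)) (at u)"
      by (rule has_vector_derivative_shift[OF du])
    then show ?case using Suc du[of a b t u] vector_derivative_unique_at by force
  qed (rule per0)
  have contu: "continuous_on {0..1} (g a b t)" for a b t
    using du by (meson continuous_at_imp_continuous_on has_vector_derivative_continuous)
  have der: "(f a has_vector_derivative f (Suc a) t) (at t)" for a t
  proof -
    have "((\<lambda>t. integral (cbox 0 1) (g a 0 t)) has_vector_derivative
        integral (cbox 0 1) (g (Suc a) 0 t)) (at t within UNIV)"
    proof (rule leibniz_rule_vector_derivative)
      show "continuous_on (UNIV \<times> cbox 0 1) (\<lambda>(t, u). g (Suc a) 0 t u)"
        by (rule continuous_on_subset[OF cont]) simp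
    qed (use dt contu in \<open>auto intro!: integrable_continuous_real\<close>)
    then show ?thesis by (simp add: f_def)
  qed
  have main: "\<bar>2 * pi * k\<bar> ^ b * norm (f a (t + of_int k)) \<le> C * H ^ (a + b) * fact a powr \<sigma> * fact b powr s"
    if t: "t \<in> {0..1}" for a b t and k :: int
    unfolding f_def quasi'
    by (rule periodic_Fourier_coeff_bound[where g = "\<lambda>b. g a b t"])
      (use du per'[of a _ t 0] bnd[OF t] in simp_all)
  have bnd_f: "norm (f a x) \<le> C * H ^ a * fact a powr \<sigma>" for a x
    using main[of "frac x" "\<lfloor>x\<rfloor>" 0 a] frac_lt_1[of x] frac_ge_0[of x] by (simp add: frac_def)
  have dec: "\<bar>x\<bar> ^ b * norm (f a x) \<le> C * H ^ (a + b) * fact a powr \<sigma> * fact b powr s"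
    if x: "\<bar>x\<bar> \<ge> 1" for a b x
  proof -
    \<comment> \<open>The decay comes from the frequency \<open>\<lfloor>x\<rfloor>\<close>, which
      is \<open>0\<close> on the unit interval; hence the restriction to
      \<open>\<bar>x\<bar> \<ge> 1\<close>. The factor \<open>2\<close> lost by rounding is covered
      by \<open>2 * pi\<close>.\<close>
    have "\<bar>x\<bar> \<le> 2 * \<bar>real_of_int \<lfloor>x\<rfloor>\<bar>"
    proof (cases "x \<ge> 1")
      case True
      then have "1 \<le> real_of_int \<lfloor>x\<rfloor>" by (simp add: le_floor_iff)
      then show ?thesis using True floor_correct[of x] by linarith
    next
      case False
      then show ?thesis using x of_int_floor_le[of x] by linarith
    qed
    also have "\<dots> \<le> (2 * pi) * \<bar>real_of_int \<lfloor>x\<rfloor>\<bar>"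
      using pi_gt3 by (intro mult_right_mono) auto
    finally have "\<bar>x\<bar> \<le> \<bar>2 * pi * real_of_int \<lfloor>x\<rfloor>\<bar>" by (simp add: abs_mult)
    then have "\<bar>x\<bar> ^ b * norm (f a x) \<le> \<bar>2 * pi * real_of_int \<lfloor>x\<rfloor>\<bar> ^ b * norm (f a x)"
      by (intro mult_right_mono power_mono) auto
    also have "\<dots> \<le> C * H ^ (a + b) * fact a powr \<sigma> * fact b powr s"
      using main[of "frac x" "\<lfloor>x\<rfloor>" b a] frac_lt_1[of x] frac_ge_0[of x] by (simp add: frac_def)
    finally show ?thesis .
  qed
  have "f 0 0 = 0"
  proof (rule rapidly_decaying_entire_eq_0[OF der C H bnd_f dec])
    fix r :: real assume r: "0 \<le> r"
    have "summable (\<lambda>a. r ^ a * fact a powr - (1 - \<sigma>))"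
      using cond s by (intro summable_power_times_fact_powr r) auto
    moreover have "fact a powr \<sigma> * r ^ a / fact a = r ^ a * fact a powr - (1 - \<sigma>)" for a
      by (simp only: fact_powr_divide_fact[symmetric]) simp
    ultimately show "summable (\<lambda>a. fact a powr \<sigma> * r ^ a / fact a)"
      by (simp only:)
  next
    have sm: "summable (\<lambda>a. H * ((2 * H\<^sup>2) ^ a * fact a powr - (1 - (s + \<sigma>))))"
      using cond by (intro summable_mult summable_power_times_fact_powr) auto
    \<comment> \<open>The shift \<open>b = Suc a\<close> brings in an extra factor
      \<open>real (Suc a) powr s\<close>. As \<open>s \<le> 1\<close>, it is at most
      \<open>2 ^ a\<close>; this is the origin of the \<open>2\<close> in
      \<open>2 * H\<^sup>2 < 1\<close>.\<close>
    have le: "H ^ (2 * a + 1) * fact a powr \<sigma> * fact (Suc a) powr s / fact a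
        \<le> H * ((2 * H\<^sup>2) ^ a * fact a powr - (1 - (s + \<sigma>)))" for a
    proof -
      have "real (Suc a) \<le> 2 ^ a"
        using less_exp[of a] by (metis Suc_leI of_nat_le_iff of_nat_numeral of_nat_power)
      moreover have "real (Suc a) powr s \<le> real (Suc a) powr 1"
        using cond \<sigma> by (intro powr_mono) auto
      ultimately have "real (Suc a) powr s \<le> 2 ^ a" by simp
      then have "fact (Suc a) powr s \<le> 2 ^ a * fact a powr s"
        by (simp add: powr_mult mult_right_mono del: of_nat_Suc)
      then have "H ^ (2 * a + 1) * fact a powr \<sigma> * fact (Suc a) powr s / fact a
          \<le> H ^ (2 * a + 1) * fact a powr \<sigma> * (2 ^ a * fact a powr s) / fact a"
        using H by (intro divide_right_mono mult_left_mono) auto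
      also have "\<dots> = H * ((2 * H\<^sup>2) ^ a * (fact a powr (s + \<sigma>) / fact a))"
      proof -
        have "H ^ (2 * a + 1) = H * (H\<^sup>2) ^ a" by (simp add: power_mult)
        then show ?thesis by (simp only:) (simp add: power_mult_distrib powr_add mult_ac)
      qed
      finally show ?thesis by (simp only: fact_powr_divide_fact)
    qed
    show "summable (\<lambda>a. H ^ (2 * a + 1) * fact a powr \<sigma> * fact (Suc a) powr s / fact a)"
    proof (rule summable_comparison_test[OF _ sm], intro exI allI impI)
      fix a
      have "0 \<le> H ^ (2 * a + 1) * fact a powr \<sigma> * fact (Suc a) powr s / fact a"
        using H by (intro divide_nonneg_nonneg mult_nonneg_nonneg) auto
      with le[of a] show "norm (H ^ (2 * a + 1) * fact a powr \<sigma> * fact (Suc a) powr s / fact a)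
          \<le> H * ((2 * H\<^sup>2) ^ a * fact a powr - (1 - (s + \<sigma>)))"
        by (simp only: real_norm_def abs_of_nonneg)
    qed
  qed
  then show ?thesis by (simp add: f_def)
qed

section \<open>Gevrey bounds by total order and the reduction to a line\<close>

lemma multi_fact_le: "multi_fact \<alpha> \<le> fact (\<Sum>i\<in>UNIV. \<alpha> i)"
proof -
  have "(\<Prod>i\<in>I. fact (\<alpha> i) :: real) \<le> fact (\<Sum>i\<in>I. \<alpha> i)" if "finite I" for I
    using that
  proof (induction I rule: finite_induct)
    case (insert i I)
    have "fact (\<alpha> i) * (\<Prod>i\<in>I. fact (\<alpha> i) :: real) \<le> fact (\<alpha> i) * fact (\<Sum>i\<in>I. \<alpha> i)"
      using insert.IH by (intro mult_left_mono) auto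
    also have "\<dots> \<le> fact (\<alpha> i + (\<Sum>i\<in>I. \<alpha> i))"
      using dvd_imp_le[OF fact_fact_dvd_fact[of "\<alpha> i" "\<Sum>i\<in>I. \<alpha> i", where 'a = nat]]
      by (metis fact_gt_zero of_nat_fact of_nat_le_iff of_nat_mult)
    finally show ?case using insert.hyps by simp
  qed simp
  then show ?thesis by (simp add: multi_fact_def)
qed

text \<open>Replacing the multi-index factorials by factorials of the total orders gives a bound
  common to all mixed partials of the same orders, as needed for directional derivatives.\<close>

lemma gevrey_boundedE:
  fixes F :: "(real^'n::finite) \<times> (real^'n) \<Rightarrow> complex"
  assumes gb: "gevrey_bounded \<sigma> s h K F" and h: "h > 0" and s: "s > 0" and \<sigma>: "\<sigma> > 0"
  obtains M where "M > 0" "\<And>\<alpha> \<beta> p. p \<in> K \<Longrightarrow> norm (mixed_deriv \<alpha> \<beta> F p) \<le>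
    M * (h ^ ((\<Sum>i\<in>UNIV. \<alpha> i) + (\<Sum>i\<in>UNIV. \<beta> i)) * fact (\<Sum>i\<in>UNIV. \<alpha> i) powr \<sigma> * fact (\<Sum>i\<in>UNIV. \<beta> i) powr s)"
proof -
  let ?d = "\<lambda>(\<alpha> :: 'n \<Rightarrow> nat) (\<beta> :: 'n \<Rightarrow> nat). h ^ (\<Sum>i\<in>UNIV. \<alpha> i + \<beta> i) * multi_fact \<alpha> powr \<sigma> * multi_fact \<beta> powr s"
  obtain M where M: "\<And>\<alpha> \<beta> p. p \<in> K \<Longrightarrow> norm (mixed_deriv \<alpha> \<beta> F p) / ?d \<alpha> \<beta> \<le> M"
    using gb unfolding gevrey_bounded_def bdd_above_def by fastforce
  show thesis
  proof (rule that[of "max M 1"])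
    fix \<alpha> \<beta> :: "'n \<Rightarrow> nat" and p assume p: "p \<in> K"
    have pos: "multi_fact \<gamma> > 0" for \<gamma> :: "'n \<Rightarrow> nat"
      unfolding multi_fact_def by (intro prod_pos) simp
    have d: "?d \<alpha> \<beta> > 0" using h pos[of \<alpha>] pos[of \<beta>] by simp
    have "norm (mixed_deriv \<alpha> \<beta> F p) \<le> M * ?d \<alpha> \<beta>"
      using M[OF p, of \<alpha> \<beta>] d by (simp add: pos_divide_le_eq)
    also have "\<dots> \<le> max M 1 * ?d \<alpha> \<beta>"
      using d by (intro mult_right_mono) auto
    also have "\<dots> \<le> max M 1 * (h ^ ((\<Sum>i\<in>UNIV. \<alpha> i) + (\<Sum>i\<in>UNIV. \<beta> i)) * fact (\<Sum>i\<in>UNIV. \<alpha> i) powr \<sigma> * fact (\<Sum>i\<in>UNIV. \<beta> i) powr s)"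
      unfolding sum.distrib using h s \<sigma> pos[of \<alpha>] pos[of \<beta>]
      by (intro mult_left_mono mult_mono powr_mono2 multi_fact_le) auto
    finally show "norm (mixed_deriv \<alpha> \<beta> F p) \<le> max M 1 * (h ^ ((\<Sum>i\<in>UNIV. \<alpha> i) + (\<Sum>i\<in>UNIV. \<beta> i)) * fact (\<Sum>i\<in>UNIV. \<alpha> i) powr \<sigma> * fact (\<Sum>i\<in>UNIV. \<beta> i) powr s)" .
  qed simp
qed

lemma basis_lattice_multiple: "of_int k *\<^sub>R E j \<in> basis_lattice E"
proof -
  have "(\<Sum>i\<in>UNIV. of_int (if i = j then k else 0) *\<^sub>R E i) = of_int k *\<^sub>R E j"
    by (simp add: if_distrib[of of_int] if_distrib[of "\<lambda>c. c *\<^sub>R _"] cong: if_cong)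
  then show ?thesis unfolding basis_lattice_def by (auto intro!: exI[of _ "\<lambda>i. if i = j then k else 0"])
qed

text \<open>\<open>L\<close> is the loss per derivative in passing from coordinates to the
  directions of \<open>E j\<close> and its dual vector. Letting \<open>h\<close> depend on
  \<open>L\<close> treats both cases together: in the critical one \<open>h * L\<close> has to be
  small.\<close>

lemma quasi_periodic_gevrey_eq_0:
  fixes E :: "'n::finite \<Rightarrow> real^'n"
  assumes E: "ordered_basis E" and s: "s > 0" and \<sigma>: "\<sigma> > 0"
    and sm: "smooth_fun F" and qp: "quasi_periodic E F"
    and gb: "\<And>K L. compact K \<Longrightarrow> L > 0 \<Longrightarrow> \<exists>h>0. gevrey_bounded \<sigma> s h K F \<and>
      (s + \<sigma> < 1 \<or> s + \<sigma> = 1 \<and> 2 * (h * L)\<^sup>2 < 1)"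
  shows "F = (\<lambda>_. 0)"
proof
  fix p :: "(real^'n) \<times> (real^'n)"
  obtain x \<xi> where p: "p = (x, \<xi>)" by (cases p)
  obtain j :: 'n where True by simp
  define v where "v = E j"
  define w where "w = dual_basis E j"
  have vw: "v \<bullet> w = 2 * pi" using dual_basis[OF E, of j j] by (simp add: v_def w_def)
  have shift_x: "F (y + of_int k *\<^sub>R v, \<eta>) = exp (\<i> * of_real (of_int k * (v \<bullet> \<eta>))) * F (y, \<eta>)" for y \<eta> k
    using qp basis_lattice_multiple[of k E j] unfolding quasi_periodic_def v_def by simp
  have shift_\<xi>: "F (y, \<eta> + of_int k *\<^sub>R w) = F (y, \<eta>)" for y \<eta> k
    using qp basis_lattice_multiple[of k "dual_basis E" j] unfolding quasi_periodic_def w_def by simp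
  define L where "L = (\<Sum>i\<in>UNIV. \<bar>v $ i\<bar>) + (\<Sum>i\<in>UNIV. \<bar>w $ i\<bar>) + 1"
  have L: "L > 0" "(\<Sum>i\<in>UNIV. \<bar>v $ i\<bar>) \<le> L" "(\<Sum>i\<in>UNIV. \<bar>w $ i\<bar>) \<le> L"
    unfolding L_def by (auto intro!: add_nonneg_pos add_nonneg_nonneg sum_nonneg add_increasing add_increasing2)
  define D where "D = (\<lambda>a b. (dir_deriv (v, 0) ^^ a) ((dir_deriv (0, w) ^^ b) F))"
  have smD: "smooth_fun (D a b)" for a b
    unfolding D_def by (intro smooth_fun_dir_deriv_funpow sm)
  have D_v: "dir_deriv (v, 0) (D a b) = D (Suc a) b" for a b
    by (simp add: D_def)
  have D_w: "dir_deriv (0, w) (D a b) = D a (Suc b)" for a b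
    unfolding D_def by (simp add: dir_deriv_funpow_commute smooth_fun_dir_deriv_funpow sm)
  \<comment> \<open>For \<open>v \<bullet> \<eta> = 0\<close> the pairing of \<open>v\<close> with
    \<open>\<eta> + u *\<^sub>R w\<close> is \<open>2 * pi * u\<close>, so translation by
    \<open>k\<close> times \<open>v\<close> multiplies by exactly the \<open>k\<close>-th character
    of the unit interval.\<close>
  have mean0: "integral {0..1} (\<lambda>u. F (y, \<eta> + u *\<^sub>R w)) = 0" if \<eta>: "v \<bullet> \<eta> = 0" for y \<eta>
  proof -
    define g where "g = (\<lambda>a b t u. D a b (y + t *\<^sub>R v, \<eta> + u *\<^sub>R w))"
    define K where "K = (\<lambda>q. (y + fst q *\<^sub>R v, \<eta> + snd q *\<^sub>R w)) ` ({0..1} \<times> {0..1::real})"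
    have "compact K"
      unfolding K_def by (intro compact_continuous_image continuous_intros compact_Times compact_Icc)
    from gb[OF this L(1)] obtain h where h: "h > 0" "gevrey_bounded \<sigma> s h K F"
      and cond: "s + \<sigma> < 1 \<or> s + \<sigma> = 1 \<and> 2 * (h * L)\<^sup>2 < 1" by blast
    obtain M where M: "M > 0" and bnd: "\<And>\<alpha> \<beta> p. p \<in> K \<Longrightarrow> norm (mixed_deriv \<alpha> \<beta> F p) \<le>
        M * (h ^ ((\<Sum>i\<in>UNIV. \<alpha> i) + (\<Sum>i\<in>UNIV. \<beta> i)) * fact (\<Sum>i\<in>UNIV. \<alpha> i) powr \<sigma> * fact (\<Sum>i\<in>UNIV. \<beta> i) powr s)"
      using gevrey_boundedE[OF h(2,1) s \<sigma>] by blast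
    have "integral {0..1} (g 0 0 0) = 0"
    proof (rule Zak_line_mean_eq_0[where g = g and C = M and H = "h * L", OF _ _ _ _ _ _ M _ s \<sigma> cond])
      show "((\<lambda>t. g a b t u) has_vector_derivative g (Suc a) b t u) (at t)" for a b t u
        using smooth_fun_line_derivative[OF smD[of a b], of "(y, \<eta> + u *\<^sub>R w)" "(v, 0)" t UNIV]
        by (simp add: g_def D_v)
      show "(g a b t has_vector_derivative g a (Suc b) t u) (at u)" for a b t u
        using smooth_fun_line_derivative[OF smD[of a b], of "(y + t *\<^sub>R v, \<eta>)" "(0, w)" u UNIV]
        by (simp add: g_def D_w)
      show "continuous_on UNIV (\<lambda>(t, u). g a b t u)" for a b
        unfolding g_def split_beta
        by (rule continuous_on_compose2[OF smooth_fun_continuous[OF smD, of UNIV]])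
          (auto intro!: continuous_intros)
      show "g 0 0 (t + k) u = exp (2 * pi * \<i> * k * u) * g 0 0 t u" for t u :: real and k :: int
        using shift_x[of "y + t *\<^sub>R v" k "\<eta> + u *\<^sub>R w"]
        by (simp add: g_def D_def \<eta> vw inner_add_right scaleR_add_left add.assoc mult_ac)
      show "g 0 0 t (u + 1) = g 0 0 t u" for t u
        using shift_\<xi>[of "y + t *\<^sub>R v" "\<eta> + u *\<^sub>R w" 1]
        by (simp add: g_def D_def scaleR_add_left add.assoc)
      show "0 < h * L" using h L by simp
      fix a b and t u :: real
      assume tu: "t \<in> {0..1}" "u \<in> {0..1}"
      define B where "B = M * (h ^ (a + b) * fact a powr \<sigma> * fact b powr s)"
      have B: "B \<ge> 0" using M h by (simp add: B_def)
      have "(y + t *\<^sub>R v, \<eta> + u *\<^sub>R w) \<in> K" using tu by (force simp: K_def)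
      then have "norm (g a b t u) \<le> (\<Sum>i\<in>UNIV. \<bar>v $ i\<bar>) ^ a * ((\<Sum>i\<in>UNIV. \<bar>w $ i\<bar>) ^ b * B)"
        unfolding g_def D_def B_def using bnd by (intro norm_dir_deriv_funpow_le[OF sm]) metis
      also have "\<dots> \<le> L ^ a * (L ^ b * B)"
        using L B by (intro mult_mono power_mono mult_nonneg_nonneg sum_nonneg zero_le_power) auto
      also have "\<dots> = M * (h * L) ^ (a + b) * fact a powr \<sigma> * fact b powr s"
        by (simp add: B_def power_mult_distrib power_add mult_ac)
      finally show "norm (g a b t u) \<le> M * (h * L) ^ (a + b) * fact a powr \<sigma> * fact b powr s" .
    qed
    then show ?thesis by (simp add: g_def D_def)
  qed
  \<comment> \<open>Removing the multiple \<open>c\<close> of \<open>w\<close> makes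
    \<open>\<xi>\<^sub>0\<close> orthogonal to \<open>v\<close>, so \<open>\<xi>\<close> lies on an
    admissible line at parameter \<open>c\<close>. Periodicity along \<open>w\<close> moves the
    parameter to \<open>frac c\<close> in the unit interval.\<close>
  define c where "c = (v \<bullet> \<xi>) / (2 * pi)"
  define \<xi>\<^sub>0 where "\<xi>\<^sub>0 = \<xi> - c *\<^sub>R w"
  have \<xi>\<^sub>0: "v \<bullet> \<xi>\<^sub>0 = 0" by (simp add: \<xi>\<^sub>0_def c_def inner_diff_right vw)
  have "F (x, \<xi>\<^sub>0 + frac c *\<^sub>R w) = 0"
  proof (rule periodic_eq_0_if_Fourier_coeffs_0[where h = "\<lambda>u. F (x, \<xi>\<^sub>0 + u *\<^sub>R w)"])
    show "continuous_on {0..1} (\<lambda>u. F (x, \<xi>\<^sub>0 + u *\<^sub>R w))"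
      by (rule continuous_on_compose2[OF smooth_fun_continuous[OF sm, of UNIV]])
        (auto intro!: continuous_intros)
    show "F (x, \<xi>\<^sub>0 + 0 *\<^sub>R w) = F (x, \<xi>\<^sub>0 + 1 *\<^sub>R w)"
      using shift_\<xi>[of x \<xi>\<^sub>0 1] by simp
    show "frac c \<in> {0..1}" using frac_lt_1[of c] by simp
    fix k :: int
    have "exp (2 * pi * \<i> * k * u) * F (x, \<xi>\<^sub>0 + u *\<^sub>R w) = F (x + of_int k *\<^sub>R v, \<xi>\<^sub>0 + u *\<^sub>R w)" for u
      unfolding shift_x by (simp add: inner_add_right \<xi>\<^sub>0 vw mult_ac)
    then show "integral {0..1} (\<lambda>u. exp (2 * pi * \<i> * k * u) * F (x, \<xi>\<^sub>0 + u *\<^sub>R w)) = 0"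
      using mean0[OF \<xi>\<^sub>0] by simp
  qed
  moreover have "(\<xi>\<^sub>0 + frac c *\<^sub>R w) + of_int \<lfloor>c\<rfloor> *\<^sub>R w = \<xi>"
    by (simp add: \<xi>\<^sub>0_def frac_def algebra_simps)
  ultimately show "F p = 0" using shift_\<xi>[of x "\<xi>\<^sub>0 + frac c *\<^sub>R w" "\<lfloor>c\<rfloor>"] p by simp
qed

theorem corollary3p3:
  fixes s \<sigma> :: real and E :: "'n::finite \<Rightarrow> real^'n"
  assumes "s > 0" and "\<sigma> > 0" and "ordered_basis E"
  shows "(\<forall>F. s + \<sigma> < 1 \<and> F \<in> zak_gevrey \<sigma> s E \<longrightarrow> F = (\<lambda>_. 0)) \<and>
         (\<forall>F. (s + \<sigma> < 1 \<or> (s = 1/2 \<and> \<sigma> = 1/2)) \<and> F \<in> zak_gevrey0 \<sigma> s E \<longrightarrow> F = (\<lambda>_. 0))"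
proof (intro conjI allI impI; elim conjE)
  fix F assume "s + \<sigma> < 1" "F \<in> zak_gevrey \<sigma> s E"
  then show "F = (\<lambda>_. 0)"
    by (intro quasi_periodic_gevrey_eq_0[OF assms(3,1,2)]) (auto simp: zak_gevrey_def)
next
  fix F assume cond: "s + \<sigma> < 1 \<or> (s = 1/2 \<and> \<sigma> = 1/2)" and F: "F \<in> zak_gevrey0 \<sigma> s E"
  show "F = (\<lambda>_. 0)"
  proof (rule quasi_periodic_gevrey_eq_0[OF assms(3,1,2)])
    fix K :: "((real^'n) \<times> (real^'n)) set" and L :: real
    assume K: "compact K" and L: "L > 0"
    \<comment> \<open>With \<open>h = 1 / (2 * L)\<close> the product \<open>h * L\<close> is
      \<open>1/2\<close>, and twice its square is \<open>1/2\<close>.\<close>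
    have "gevrey_bounded \<sigma> s (1 / (2 * L)) K F" using F K L by (simp add: zak_gevrey0_def)
    moreover have "2 * (1 / (2 * L) * L)\<^sup>2 < 1" using L by (simp add: power2_eq_square)
    ultimately show "\<exists>h>0. gevrey_bounded \<sigma> s h K F \<and> (s + \<sigma> < 1 \<or> s + \<sigma> = 1 \<and> 2 * (h * L)\<^sup>2 < 1)"
      using cond L by (intro exI[of _ "1 / (2 * L)"]) auto
  qed (use F in \<open>simp_all add: zak_gevrey0_def\<close>)
qed

end
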